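(* Let $\mathcal{M}$ be a natural class of matroids. Let $L$ and $N$ be matroids with $E(N)\cap E(L)=\emptyset$, let $p,q$ be distinct elements of $L$, and let $(A,B)$ be a partition of $E(N)$ into two bases of $N$. Suppose that (i) $L$ is an excluded minor for $\mathcal{M}$; (ii) $\{p,q\}$ is an incomparable pair of elements of $L$ such that $L_{p\rightarrow q}$ and $L_{q\rightarrow p}$ are in $\mathcal{M}$; (iii) $N\in\mathcal{M}$. Then every proper minor of $M(L,p,q;N,A,B)$ is in $\mathcal{M}$.
   Context: Freely placing a new element $x$ in a flat $F$ of a matroid $K$ (a principal extension) means forming the matroid $K'$ on $E(K)\cup\{x\}$ with $K'\setminus x=K$ such that a subset of $E(K)$ spans $x$ iff it spans $F$. A class of matroids is natural if it is closed under isomorphism, minors, adding coloops, principal extensions, and direct sums. An excluded minor for $\mathcal{M}$ is a matroid not in $\mathcal{M}$ all of whose proper minors are in $\mathcal{M}$. Distinct elements $p,q$ of $L$ form an incomparable pair if some subset of $E(L)\setminus\{p,q\}$ spans $p$ but not $q$ and some subset spans $q$ but not $p$. For distinct elements $u,v$ of a matroid $K$, $K_{u\rightarrow v}$ is obtained by freely placing a new element $c$ in $\mathrm{cl}_K(\{u,v\})$, deleting $u$, and relabelling $c$ as $u$. Construction: $M_1(L,p,q;N,A,B)$ is obtained from $N\oplus L$ by freely placing new elements $a$ and $b$ in the flats spanned by $E(N)\cup\{p\}$ and $E(N)\cup\{q\}$ respectively, then, for each $x\in A$, freely placing a new element $x_a$ in the flat spanned by $\{x,a\}$, and for each $y\in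 B$, freely placing a new element $y_b$ in the flat spanned by $\{y,b\}$. $M_2(L,p,q;N,A,B)$ is obtained by deleting every $x\in A$, $y\in B$ and relabelling $x_a$ as $x$ and $y_b$ as $y$. $M(L,p,q;N,A,B)=M_2(L,p,q;N,A,B)\setminus\{p,q\}$. *)

theory Defs
  imports Main
begin

datatype 'a mat = Mat (ground: "'a set") (indeps: "'a set set")

definition matroid :: "'a mat \<Rightarrow> bool" where
  "matroid K \<longleftrightarrow>
     finite (ground K) \<and>
     indeps K \<subseteq> Pow (ground K) \<and>
     {} \<in> indeps K \<and>
     (\<forall>I J. J \<in> indeps K \<longrightarrow> I \<subseteq> J \<longrightarrow> I \<in> indeps K) \<and>
     (\<forall>I\<in>indeps K. \<forall>J\<in>indeps K. card I < card J \<longrightarrow> (\<exists>e\<in>J - I. insert e I \<in> indeps K))"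

definition rank :: "'a mat \<Rightarrow> 'a set \<Rightarrow> nat" where
  "rank K S = Max (card ` {I \<in> indeps K. I \<subseteq> S})"

definition cl :: "'a mat \<Rightarrow> 'a set \<Rightarrow> 'a set" where
  "cl K S = {e \<in> ground K. rank K (insert e S) = rank K S}"

definition spans :: "'a mat \<Rightarrow> 'a set \<Rightarrow> 'a set \<Rightarrow> bool" where
  "spans K S T \<longleftrightarrow> T \<subseteq> cl K S"

definition flat :: "'a mat \<Rightarrow> 'a set \<Rightarrow> bool" where
  "flat K F \<longleftrightarrow> F \<subseteq> ground K \<and> cl K F = F"

definition basis_of :: "'a mat \<Rightarrow> 'a set \<Rightarrow> 'a set \<Rightarrow> bool" where
  "basis_of K X B \<longleftrightarrow>
     B \<in> indeps K \<and> B \<subseteq> X \<and> (\<forall>B'\<in>indeps K. B \<subseteq> B' \<longrightarrow> B' \<subseteq> X \<longrightarrow> B' = B)"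

definition base :: "'a mat \<Rightarrow> 'a set \<Rightarrow> bool" where
  "base K B \<longleftrightarrow> basis_of K (ground K) B"

definition delete :: "'a mat \<Rightarrow> 'a set \<Rightarrow> 'a mat" where
  "delete K D = Mat (ground K - D) {I \<in> indeps K. I \<inter> D = {}}"

definition contract :: "'a mat \<Rightarrow> 'a set \<Rightarrow> 'a mat" where
  "contract K C =
     Mat (ground K - C) {I. I \<subseteq> ground K - C \<and> (\<exists>B. basis_of K C B \<and> I \<union> B \<in> indeps K)}"

definition minor :: "'a mat \<Rightarrow> 'a mat \<Rightarrow> bool" where
  "minor K' K \<longleftrightarrow>
     (\<exists>C D. C \<subseteq> ground K \<and> D \<subseteq> ground K \<and> C \<inter> D = {} \<and> K' = delete (contract K C) D)"

definition proper_minor :: "'a mat \<Rightarrow> 'a mat \<Rightarrow> bool" where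
  "proper_minor K' K \<longleftrightarrow>
     (\<exists>C D. C \<subseteq> ground K \<and> D \<subseteq> ground K \<and> C \<inter> D = {} \<and> C \<union> D \<noteq> {} \<and>
        K' = delete (contract K C) D)"

definition isomorphic :: "'a mat \<Rightarrow> 'a mat \<Rightarrow> bool" where
  "isomorphic K K' \<longleftrightarrow>
     (\<exists>f. bij_betw f (ground K) (ground K') \<and>
          (\<forall>S\<subseteq>ground K. S \<in> indeps K \<longleftrightarrow> f ` S \<in> indeps K'))"

text \<open>Only meaningful if \<open>f\<close> is injective on the ground set.\<close>

definition relabel :: "('a \<Rightarrow> 'a) \<Rightarrow> 'a mat \<Rightarrow> 'a mat" where
  "relabel f K = Mat (f ` ground K) ((`) f ` indeps K)"

text \<open>Only meaningful if the two ground sets are disjoint.\<close>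

definition direct_sum :: "'a mat \<Rightarrow> 'a mat \<Rightarrow> 'a mat" where
  "direct_sum K K' = Mat (ground K \<union> ground K') {I \<union> J | I J. I \<in> indeps K \<and> J \<in> indeps K'}"

definition add_coloop :: "'a mat \<Rightarrow> 'a \<Rightarrow> 'a mat" where
  "add_coloop K x = direct_sum K (Mat {x} {{}, {x}})"

definition principal_extension :: "'a mat \<Rightarrow> 'a set \<Rightarrow> 'a \<Rightarrow> 'a mat \<Rightarrow> bool" where
  "principal_extension K F x K' \<longleftrightarrow>
     matroid K' \<and> ground K' = insert x (ground K) \<and> delete K' {x} = K \<and>
     (\<forall>S\<subseteq>ground K. spans K' S {x} \<longleftrightarrow> spans K S F)"

text \<open>
  For a matroid \<open>K\<close>, a flat \<open>F\<close> and \<open>x \<notin> ground K\<close>, the principal extension exists and is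
  unique: its independent sets are those of \<open>K\<close> together with the sets \<open>insert x I\<close> for \<open>I\<close>
  independent in \<open>K\<close> and not spanning \<open>F\<close>.
\<close>

definition freely_place :: "'a mat \<Rightarrow> 'a set \<Rightarrow> 'a \<Rightarrow> 'a mat" where
  "freely_place K F x = (THE K'. principal_extension K F x K')"

text \<open>
  All matroids live on finite subsets of one type \<open>'a\<close>. If \<open>'a\<close> is infinite, an
  isomorphism-closed class of finite matroids is determined by its members on \<open>'a\<close>.
\<close>

definition natural_class :: "'a mat set \<Rightarrow> bool" where
  "natural_class \<M> \<longleftrightarrow>
     (\<forall>K\<in>\<M>. matroid K) \<and>
     (\<forall>K\<in>\<M>. \<forall>K'. matroid K' \<longrightarrow> isomorphic K K' \<longrightarrow> K' \<in> \<M>) \<and>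
     (\<forall>K\<in>\<M>. \<forall>K'. minor K' K \<longrightarrow> K' \<in> \<M>) \<and>
     (\<forall>K\<in>\<M>. \<forall>x. x \<notin> ground K \<longrightarrow> add_coloop K x \<in> \<M>) \<and>
     (\<forall>K\<in>\<M>. \<forall>F x. flat K F \<longrightarrow> x \<notin> ground K \<longrightarrow> freely_place K F x \<in> \<M>) \<and>
     (\<forall>K\<in>\<M>. \<forall>K'\<in>\<M>. ground K \<inter> ground K' = {} \<longrightarrow> direct_sum K K' \<in> \<M>)"

definition excluded_minor :: "'a mat set \<Rightarrow> 'a mat \<Rightarrow> bool" where
  "excluded_minor \<M> K \<longleftrightarrow> matroid K \<and> K \<notin> \<M> \<and> (\<forall>K'. proper_minor K' K \<longrightarrow> K' \<in> \<M>)"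

definition incomparable_pair :: "'a mat \<Rightarrow> 'a \<Rightarrow> 'a \<Rightarrow> bool" where
  "incomparable_pair L p q \<longleftrightarrow>
     p \<in> ground L \<and> q \<in> ground L \<and> p \<noteq> q \<and>
     (\<exists>S\<subseteq>ground L - {p, q}. spans L S {p} \<and> \<not> spans L S {q}) \<and>
     (\<exists>S\<subseteq>ground L - {p, q}. spans L S {q} \<and> \<not> spans L S {p})"

text \<open>
  The matroid $K_{u \to v}$. It does not depend on the chosen auxiliary element \<open>c\<close>, which exists
  whenever \<open>'a\<close> is infinite.
\<close>

definition shift :: "'a mat \<Rightarrow> 'a \<Rightarrow> 'a \<Rightarrow> 'a mat" where
  "shift K u v =
     (let c = (SOME c. c \<notin> ground K)
      in relabel (id(c := u)) (delete (freely_place K (cl K {u, v}) c) {u}))"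

text \<open>
  In the constructions below the distinct lists \<open>xs\<close> and \<open>ys\<close> enumerate the bases \<open>A\<close> and \<open>B\<close> of
  \<open>N\<close>, in the order in which the new elements are placed; \<open>a\<close> and \<open>b\<close> are the new elements of the
  same name, and \<open>nw\<close> supplies the labels of the remaining ones: \<open>nw x\<close> is $x_a$ for \<open>x \<in> A\<close>, and
  \<open>nw y\<close> is $y_b$ for \<open>y \<in> B\<close>.
\<close>

definition fresh_labels :: "'a mat \<Rightarrow> 'a mat \<Rightarrow> 'a \<Rightarrow> 'a \<Rightarrow> ('a \<Rightarrow> 'a) \<Rightarrow> bool" where
  "fresh_labels L N a b nw \<longleftrightarrow>
     a \<noteq> b \<and> a \<notin> ground N \<union> ground L \<and> b \<notin> ground N \<union> ground L \<and>
     inj_on nw (ground N) \<and> nw ` ground N \<inter> (ground N \<union> ground L \<union> {a, b}) = {}"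

definition M1 ::
  "'a mat \<Rightarrow> 'a \<Rightarrow> 'a \<Rightarrow> 'a mat \<Rightarrow> 'a list \<Rightarrow> 'a list \<Rightarrow> 'a \<Rightarrow> 'a \<Rightarrow> ('a \<Rightarrow> 'a) \<Rightarrow> 'a mat" where
  "M1 L p q N xs ys a b nw =
     (let K0 = direct_sum N L;
          Ka = freely_place K0 (cl K0 (insert p (ground N))) a;
          Kb = freely_place Ka (cl Ka (insert q (ground N))) b;
          KA = fold (\<lambda>x K. freely_place K (cl K {x, a}) (nw x)) xs Kb
      in fold (\<lambda>y K. freely_place K (cl K {y, b}) (nw y)) ys KA)"

definition M2 ::
  "'a mat \<Rightarrow> 'a \<Rightarrow> 'a \<Rightarrow> 'a mat \<Rightarrow> 'a list \<Rightarrow> 'a list \<Rightarrow> 'a \<Rightarrow> 'a \<Rightarrow> ('a \<Rightarrow> 'a) \<Rightarrow> 'a mat" where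
  "M2 L p q N xs ys a b nw =
     relabel (\<lambda>z. if z \<in> nw ` ground N then inv_into (ground N) nw z else z)
       (delete (M1 L p q N xs ys a b nw) (set xs \<union> set ys))"

definition M ::
  "'a mat \<Rightarrow> 'a \<Rightarrow> 'a \<Rightarrow> 'a mat \<Rightarrow> 'a list \<Rightarrow> 'a list \<Rightarrow> 'a \<Rightarrow> 'a \<Rightarrow> ('a \<Rightarrow> 'a) \<Rightarrow> 'a mat" where
  "M L p q N xs ys a b nw = delete (M2 L p q N xs ys a b nw) {p, q}"

end

theory Submission
  imports Defs
begin

text \<open>
  A freely placed element is a generic point of its flat, so a set using it is independent iff the
  element can be specialised to some element of a spanning set of the flat. Applied to all the
  placements, this says: \<open>I\<close> is independent in \<open>M(L,p,q;N,A,B)\<close> iff \<open>I\<close> becomes an independent set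
  of \<open>N \<oplus> L\<close> of the same size after replacing \<open>a\<close> (or, if \<open>a \<notin> I\<close>, at most one element of
  \<open>I \<inter> A\<close>) by an element of \<open>E(N) \<union> {p}\<close>, and likewise \<open>b\<close> or one element of \<open>I \<inter> B\<close> by an element
  of \<open>E(N) \<union> {q}\<close>.

  From this description, \<open>M(L)\<close> and \<open>M(L\<^sub>p\<^sub>\<rightarrow>\<^sub>q)\<close> have the same independent sets except
  possibly those that contain \<open>A \<union> {a}\<close> and avoid \<open>B \<union> {b}\<close>: if the independence of \<open>I\<close> in
  \<open>M(L\<^sub>p\<^sub>\<rightarrow>\<^sub>q)\<close> uses \<open>p\<close> in the place of \<open>q\<close>, then \<open>q\<close> is obtained from \<open>b\<close> or from an element
  of \<open>B\<close> instead, or, if \<open>I\<close> avoids \<open>B \<union> {b}\<close>, \<open>p\<close> is not needed because \<open>A\<close> is a basis of \<open>N\<close>.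
  Hence deleting an element of \<open>A \<union> {a}\<close> or contracting an element of \<open>B \<union> {b}\<close> gives a minor of
  \<open>M(L\<^sub>p\<^sub>\<rightarrow>\<^sub>q)\<close>, which is in the class; the other two cases are symmetric. Finally
  \<open>M(L)\<close> with \<open>e \<in> E(L) - {p, q}\<close> deleted or contracted is \<open>M(L')\<close> for the corresponding proper
  minor \<open>L'\<close> of \<open>L\<close>.
\<close>

subsection \<open>Bases, closure and minors\<close>

lemma matroid_finite: "matroid K \<Longrightarrow> finite (ground K)"
  by (simp add: matroid_def)

lemma indep_ground: "matroid K \<Longrightarrow> I \<in> indeps K \<Longrightarrow> I \<subseteq> ground K"
  by (auto simp: matroid_def)

lemma indep_finite: "matroid K \<Longrightarrow> I \<in> indeps K \<Longrightarrow> finite I"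
  by (meson indep_ground matroid_finite finite_subset)

lemma indep_empty: "matroid K \<Longrightarrow> {} \<in> indeps K"
  by (simp add: matroid_def)

lemma indep_subset: "matroid K \<Longrightarrow> J \<in> indeps K \<Longrightarrow> I \<subseteq> J \<Longrightarrow> I \<in> indeps K"
  unfolding matroid_def by blast

lemma indep_augment:
  assumes "matroid K" "I \<in> indeps K" "J \<in> indeps K" "card I < card J"
  obtains e where "e \<in> J" "e \<notin> I" "insert e I \<in> indeps K"
  using assms unfolding matroid_def by (meson DiffD1 DiffD2)

lemma basis_ofD:
  assumes "basis_of K X B"
  shows "B \<in> indeps K" "B \<subseteq> X"
  using assms by (auto simp: basis_of_def)

lemma basis_of_maximal:
  assumes "basis_of K X B" "e \<in> X" "e \<notin> B"
  shows "insert e B \<notin> indeps K"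
  using assms unfolding basis_of_def by (metis insert_subset subset_insertI insertI1)

lemma basis_ofI:
  assumes "matroid K" "B \<in> indeps K" "B \<subseteq> X" "\<And>e. e \<in> X \<Longrightarrow> e \<notin> B \<Longrightarrow> insert e B \<notin> indeps K"
  shows "basis_of K X B"
  unfolding basis_of_def
proof (intro conjI ballI impI)
  fix B' assume B': "B' \<in> indeps K" "B \<subseteq> B'" "B' \<subseteq> X"
  show "B' = B"
  proof (rule ccontr)
    assume "B' \<noteq> B"
    then obtain e where e: "e \<in> B'" "e \<notin> B" using B' by blast
    have "insert e B \<in> indeps K"
      by (rule indep_subset[OF assms(1) B'(1)]) (use e B' in auto)
    with assms(4) e B' show False by blast
  qed
qed (use assms in auto)

lemma basis_of_card_max:
  assumes "matroid K" "basis_of K X B" "I \<in> indeps K" "I \<subseteq> X"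
  shows "card I \<le> card B"
proof (rule ccontr)
  assume "\<not> ?thesis"
  then obtain e where "e \<in> I" "e \<notin> B" "insert e B \<in> indeps K"
    by (meson indep_augment[OF assms(1)] basis_ofD(1)[OF assms(2)] assms(3) not_le)
  then show False using basis_of_maximal[OF assms(2)] assms(4) by blast
qed

lemma basis_of_extend:
  assumes "matroid K" "I \<in> indeps K" "I \<subseteq> X"
  obtains B where "basis_of K X B" "I \<subseteq> B"
proof -
  let ?F = "{B \<in> indeps K. I \<subseteq> B \<and> B \<subseteq> X}"
  have "finite ?F"
    by (rule finite_subset[of _ "Pow (ground K)"])
       (use assms matroid_finite indep_ground[OF assms(1)] in auto)
  moreover have "I \<in> ?F" using assms by auto
  ultimately obtain B where B: "B \<in> ?F" "\<And>B'. B' \<in> ?F \<Longrightarrow> B \<subseteq> B' \<Longrightarrow> B = B'"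
    by (metis (no_types, lifting) empty_iff finite_has_maximal)
  have "basis_of K X B"
    unfolding basis_of_def using B by auto
  with B show ?thesis using that by auto
qed

lemma rank_eq_card_basis:
  assumes "matroid K" "basis_of K X B"
  shows "rank K X = card B"
  unfolding rank_def
proof (rule Max_eqI)
  show "finite (card ` {I \<in> indeps K. I \<subseteq> X})"
    by (rule finite_imageI, rule finite_subset[of _ "Pow (ground K)"])
       (use assms matroid_finite indep_ground[OF assms(1)] in auto)
  show "card B \<in> card ` {I \<in> indeps K. I \<subseteq> X}" using basis_ofD[OF assms(2)] by blast
qed (use assms basis_of_card_max in auto)

text \<open>Trades the rank function for a single basis. If \<open>e\<close> fails to extend
  \<open>B\<close>, then \<open>B\<close> is still a basis of \<open>insert e X\<close> and the
  ranks agree; otherwise a basis containing \<open>insert e B\<close> is strictly larger.\<close>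

lemma cl_iff_basis:
  assumes K: "matroid K" and B: "basis_of K X B"
  shows "e \<in> cl K X \<longleftrightarrow> e \<in> ground K \<and> (e \<in> B \<or> insert e B \<notin> indeps K)"
proof -
  have "rank K (insert e X) = rank K X \<longleftrightarrow> e \<in> B \<or> insert e B \<notin> indeps K"
  proof (cases "e \<in> B \<or> insert e B \<notin> indeps K")
    case True
    then have "basis_of K (insert e X) B"
      using basis_of_maximal[OF B] basis_ofD[OF B] by (intro basis_ofI[OF K]) auto
    then show ?thesis using True rank_eq_card_basis[OF K] B by metis
  next
    case False
    then obtain B' where B': "basis_of K (insert e X) B'" "insert e B \<subseteq> B'"
      using basis_of_extend[OF K, of "insert e B" "insert e X"] basis_ofD[OF B] by blast
    have "finite B'" using B' basis_ofD(1) indep_finite[OF K] by metis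
    with B' False have "card B < card B'"
      by (metis insert_subset psubsetI psubset_card_mono)
    then show ?thesis using False rank_eq_card_basis[OF K] B B' by (metis less_irrefl)
  qed
  then show ?thesis by (auto simp: cl_def)
qed

lemma basis_of_exists:
  assumes "matroid K"
  obtains B where "basis_of K X B"
  using basis_of_extend[OF assms indep_empty[OF assms]] by blast

lemma basis_of_indep: "matroid K \<Longrightarrow> I \<in> indeps K \<Longrightarrow> basis_of K I I"
  by (auto simp: basis_of_def)

lemma cl_indep_iff:
  assumes "matroid K" "I \<in> indeps K"
  shows "e \<in> cl K I \<longleftrightarrow> e \<in> ground K \<and> (e \<in> I \<or> insert e I \<notin> indeps K)"
  by (rule cl_iff_basis[OF assms(1) basis_of_indep[OF assms]])

lemma cl_eq_cl_basis:
  assumes "matroid K" "basis_of K X B"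
  shows "cl K X = cl K B"
  using cl_iff_basis[OF assms] cl_indep_iff[OF assms(1) basis_ofD(1)[OF assms(2)]] by blast

lemma subset_cl: "X \<subseteq> ground K \<Longrightarrow> X \<subseteq> cl K X"
  by (auto simp: cl_def insert_absorb)

lemma basis_of_cl:
  assumes K: "matroid K" and B: "basis_of K X B"
  shows "basis_of K (cl K X) B"
proof (rule basis_ofI[OF K])
  show "B \<in> indeps K" using basis_ofD[OF B] by blast
  then show "B \<subseteq> cl K X"
    using cl_iff_basis[OF K B] indep_ground[OF K] by blast
qed (use cl_iff_basis[OF K B] in blast)

lemma flat_cl:
  assumes "matroid K"
  shows "flat K (cl K X)"
proof -
  obtain B where B: "basis_of K X B" using basis_of_exists[OF assms] .
  have "cl K (cl K X) = cl K X"
    using cl_eq_cl_basis[OF assms B] cl_eq_cl_basis[OF assms basis_of_cl[OF assms B]] by simp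
  then show ?thesis by (auto simp: flat_def cl_def)
qed

text \<open>Suppose \<open>e\<close> lies in the closure of \<open>X\<close> but not in that of
  \<open>Y\<close>. Take a basis \<open>B'\<close> of \<open>cl K Y\<close> that contains a basis
  \<open>B\<close> of \<open>X\<close>, and a basis \<open>I\<close> of \<open>Y\<close>. Augmenting
  \<open>B'\<close> from \<open>insert e I\<close> can only add \<open>e\<close>, so
  \<open>e\<close> extends \<open>B\<close>, a contradiction.\<close>

lemma cl_subset_cl_iff:
  assumes K: "matroid K" and X: "X \<subseteq> ground K"
  shows "cl K X \<subseteq> cl K Y \<longleftrightarrow> X \<subseteq> cl K Y"
proof
  assume "cl K X \<subseteq> cl K Y" then show "X \<subseteq> cl K Y" using subset_cl[OF X] by blast
next
  assume XY: "X \<subseteq> cl K Y"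
  obtain I where I: "basis_of K Y I" using basis_of_exists[OF K] .
  obtain B where B: "basis_of K X B" using basis_of_exists[OF K] .
  note I' = basis_of_cl[OF K I]
  have "B \<subseteq> cl K Y" using basis_ofD[OF B] XY by blast
  then obtain B' where B': "basis_of K (cl K Y) B'" "B \<subseteq> B'"
    using basis_of_extend[OF K] basis_ofD(1)[OF B] by metis
  show "cl K X \<subseteq> cl K Y"
  proof
    fix e assume e: "e \<in> cl K X"
    show "e \<in> cl K Y"
    proof (rule ccontr)
      assume n: "e \<notin> cl K Y"
      have eg: "e \<in> ground K" using e by (auto simp: cl_def)
      have eI: "e \<notin> I" "insert e I \<in> indeps K"
        using n eg cl_iff_basis[OF K I] by auto
      have "card I = card B'"
        using rank_eq_card_basis[OF K] I' B' by metis
      moreover have "finite I" using indep_finite[OF K] basis_ofD(1)[OF I] .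
      ultimately have "card B' < card (insert e I)" using eI by simp
      then obtain d where d: "d \<in> insert e I" "d \<notin> B'" "insert d B' \<in> indeps K"
        using indep_augment[OF K basis_ofD(1)[OF B'(1)] eI(2)] by blast
      have "d \<notin> cl K Y" using basis_of_maximal[OF B'(1)] d by blast
      then have "d = e" using d basis_ofD(2)[OF I'] by blast
      with d B' have "e \<notin> B" "insert e B \<in> indeps K"
        using indep_subset[OF K d(3)] by (blast, meson insert_mono)
      then show False using e cl_iff_basis[OF K B] by blast
    qed
  qed
qed

text \<open>This makes independence in a contraction insensitive to the basis chosen in
  \<open>contract\<close>. A maximal independent extension of \<open>B'\<close> inside
  \<open>B' \<union> I \<union> B\<close> gains only elements of \<open>I\<close>, because
  \<open>B'\<close> is maximal in \<open>X\<close>, and by its size it gains all of them.\<close>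

lemma basis_exchange_indep:
  assumes K: "matroid K" and B: "basis_of K X B" "basis_of K X B'"
    and I: "I \<union> B \<in> indeps K" "I \<inter> X = {}"
  shows "I \<union> B' \<in> indeps K"
proof -
  obtain D where D: "basis_of K (B' \<union> (I \<union> B)) D" "B' \<subseteq> D"
    using basis_of_extend[OF K basis_ofD(1)[OF B(2)]] by (metis Un_upper1)
  have fin: "finite I" "finite B" "finite D" "finite B'"
    using indep_finite[OF K] I D B basis_ofD(1) by (metis finite_Un)+
  have "card (I \<union> B) \<le> card D"
    using basis_of_card_max[OF K D(1) I(1)] by blast
  moreover have "card B = card B'" using rank_eq_card_basis[OF K] B by metis
  moreover have "card (I \<union> B) = card I + card B"
    using fin I(2) basis_ofD(2)[OF B(1)] by (intro card_Un_disjoint) auto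
  moreover have "card D = card (D - B') + card B'"
    using fin D by (metis card_Diff_subset card_mono le_add_diff_inverse2)
  ultimately have "card I \<le> card (D - B')" by simp
  moreover have "D - B' \<subseteq> I"
  proof
    fix d assume d: "d \<in> D - B'"
    have "insert d B' \<in> indeps K"
      by (rule indep_subset[OF K basis_ofD(1)[OF D(1)]]) (use d D in auto)
    then have "d \<notin> X" using basis_of_maximal[OF B(2)] d by blast
    then show "d \<in> I" using d basis_ofD(2)[OF D(1)] basis_ofD(2)[OF B(1)] by blast
  qed
  ultimately have "D - B' = I" using fin by (metis card_seteq)
  then have "I \<union> B' = D" using D by blast
  then show ?thesis using basis_ofD(1)[OF D(1)] by simp
qed

section \<open>Deletion, contraction, and reduction of minors to single elements\<close>

lemma ground_delete [simp]: "ground (delete K D) = ground K - D"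
  and indeps_delete [simp]: "indeps (delete K D) = {I \<in> indeps K. I \<inter> D = {}}"
  by (auto simp: delete_def)

lemma ground_contract [simp]: "ground (contract K C) = ground K - C"
  by (simp add: contract_def)

lemma delete_eqI:
  assumes "ground K = ground K'" "\<And>I. e \<notin> I \<Longrightarrow> I \<in> indeps K \<longleftrightarrow> I \<in> indeps K'"
  shows "delete K {e} = delete K' {e}"
  using assms by (auto simp: delete_def)

lemma contract_nonloop:
  assumes "matroid K" "{e} \<in> indeps K"
  shows "contract K {e} = Mat (ground K - {e}) {I. I \<subseteq> ground K - {e} \<and> insert e I \<in> indeps K}"
proof -
  have "basis_of K {e} B \<longleftrightarrow> B = {e}" for B
    using assms by (auto simp: basis_of_def)
  then show ?thesis by (simp add: contract_def)
qed

lemma contract_loop: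
  assumes "matroid K" "{e} \<notin> indeps K"
  shows "contract K {e} = delete K {e}"
proof -
  have "basis_of K {e} B \<longleftrightarrow> B = {}" for B
    using assms indep_empty[OF assms(1)] by (auto simp: basis_of_def subset_singleton_iff)
  then show ?thesis using indep_ground[OF assms(1)] by (auto simp: contract_def delete_def)
qed

lemma contract_empty:
  assumes "matroid K"
  shows "contract K {} = K"
proof -
  have "basis_of K {} B \<longleftrightarrow> B = {}" for B
    using indep_empty[OF assms(1)] by (auto simp: basis_of_def)
  then show ?thesis using indep_ground[OF assms(1)]
    by (intro mat.expand) (auto simp: contract_def)
qed

lemma matroid_delete:
  assumes K: "matroid K"
  shows "matroid (delete K D)"
  unfolding matroid_def
proof (intro conjI allI ballI impI)
  fix I J assume I: "I \<in> indeps (delete K D)" and J: "J \<in> indeps (delete K D)" "card I < card J"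
  then obtain e where "e \<in> J" "e \<notin> I" "insert e I \<in> indeps K"
    using indep_augment[OF K, of I J] by auto
  then show "\<exists>e\<in>J - I. insert e I \<in> indeps (delete K D)" using I J by auto
qed (use matroid_finite[OF K] indep_ground[OF K] indep_empty[OF K] in \<open>auto intro: indep_subset[OF K]\<close>)

lemma delete_delete: "delete (delete K D) D' = delete K (D \<union> D')"
  by (auto simp: delete_def)

lemma contract_delete:
  assumes "C \<inter> D = {}"
  shows "contract (delete K D) C = delete (contract K C) D"
proof -
  have s: "X \<inter> D = {}" if "X \<subseteq> C" for X using assms that by blast
  have b: "basis_of (delete K D) C B \<longleftrightarrow> basis_of K C B" for B
  proof
    assume "basis_of (delete K D) C B"
    then show "basis_of K C B" using s unfolding basis_of_def indeps_delete Ball_def mem_Collect_eq by meson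
  next
    assume "basis_of K C B"
    then show "basis_of (delete K D) C B" using s unfolding basis_of_def indeps_delete Ball_def mem_Collect_eq by meson
  qed
  have d: "B \<inter> D = {}" if "basis_of K C B" for B
    using s basis_ofD(2)[OF that] .
  show ?thesis
    unfolding contract_def delete_def using d
    by (auto simp: b[unfolded delete_def])
qed

text \<open>If \<open>e\<close> is a loop, then \<open>C\<close> and \<open>insert e C\<close> have
  the same bases. Otherwise the bases of \<open>C\<close> after contracting \<open>e\<close> are the
  bases of \<open>insert e C\<close> through \<open>e\<close>, with \<open>e\<close> removed, and
  \<open>basis_exchange_indep\<close> replaces an arbitrary basis by one through
  \<open>e\<close>.\<close>

lemma contract_insert:
  assumes K: "matroid K" and e: "e \<notin> C"
  shows "contract K (insert e C) = contract (contract K {e}) C"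
proof (cases "{e} \<in> indeps K")
  case False
  have ne: "e \<notin> B" if "B \<in> indeps K" for B
    using indep_subset[OF K that, of "{e}"] False by auto
  have "basis_of (delete K {e}) C B \<longleftrightarrow> basis_of K (insert e C) B" for B
    using ne unfolding basis_of_def by (auto 5 0)
  then show ?thesis
    unfolding contract_loop[OF K False]
    by (intro mat.expand) (auto simp: contract_def dest: ne)
next
  case True
  let ?K = "contract K {e}"
  have iK: "indeps ?K = {I. I \<subseteq> ground K - {e} \<and> insert e I \<in> indeps K}"
    by (simp add: contract_nonloop[OF K True])
  have b: "basis_of ?K C B \<longleftrightarrow> e \<notin> B \<and> basis_of K (insert e C) (insert e B)" for B
  proof
    assume B: "basis_of ?K C B"
    note B1 = basis_ofD[OF B]
    show "e \<notin> B \<and> basis_of K (insert e C) (insert e B)"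
    proof (intro conjI basis_ofI[OF K])
      show "e \<notin> B" using B1 iK by auto
      show "insert e B \<in> indeps K" using B1 iK by auto
      show "insert e B \<subseteq> insert e C" using B1 by auto
      fix d assume d: "d \<in> insert e C" "d \<notin> insert e B"
      show "insert d (insert e B) \<notin> indeps K"
      proof
        assume "insert d (insert e B) \<in> indeps K"
        then have "insert d B \<in> indeps ?K"
          using B1 d iK indep_ground[OF K] by (auto simp: insert_commute)
        then show False using basis_of_maximal[OF B] d by auto
      qed
    qed
  next
    assume B: "e \<notin> B \<and> basis_of K (insert e C) (insert e B)"
    then have B1: "insert e B \<in> indeps K" "insert e B \<subseteq> insert e C" using basis_ofD by metis+
    show "basis_of ?K C B"
      unfolding basis_of_def
    proof (intro conjI ballI impI)
      show "B \<in> indeps ?K" using B B1 iK indep_ground[OF K B1(1)] by auto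
      show "B \<subseteq> C" using B B1 by auto
      fix B' assume B': "B' \<in> indeps ?K" "B \<subseteq> B'" "B' \<subseteq> C"
      then have "insert e B' = insert e B" using B iK unfolding basis_of_def by auto
      then show "B' = B" using B B' e by auto
    qed
  qed
  obtain B0 where B0: "basis_of K (insert e C) B0" "{e} \<subseteq> B0"
    using basis_of_extend[OF K True] by (metis insertI1 empty_subsetI insert_subset)
  have "indeps (contract K (insert e C)) = indeps (contract ?K C)"
  proof (intro set_eqI iffI)
    fix I assume "I \<in> indeps (contract K (insert e C))"
    then obtain B where I: "I \<subseteq> ground K - insert e C" "basis_of K (insert e C) B" "I \<union> B \<in> indeps K"
      by (auto simp: contract_def)
    have "I \<union> B0 \<in> indeps K"
      by (rule basis_exchange_indep[OF K I(2) B0(1) I(3)]) (use I in auto)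
    moreover have "basis_of ?K C (B0 - {e})" using B0 b by (simp add: insert_absorb)
    moreover have "I \<union> (B0 - {e}) \<in> indeps ?K"
    proof -
      have "insert e (I \<union> (B0 - {e})) = I \<union> B0" using B0(2) by auto
      then show ?thesis using calculation(1) I iK indep_ground[OF K calculation(1)] by auto
    qed
    ultimately show "I \<in> indeps (contract ?K C)"
      using I by (auto simp: contract_def)
  next
    fix I assume "I \<in> indeps (contract ?K C)"
    then obtain B where I: "I \<subseteq> ground K - insert e C" "basis_of ?K C B" "I \<union> B \<in> indeps ?K"
      by (auto simp: contract_def)
    then have "basis_of K (insert e C) (insert e B)" "I \<union> insert e B \<in> indeps K"
      using b iK by auto
    then show "I \<in> indeps (contract K (insert e C))"
      using I by (auto simp: contract_def)
  qed
  then show ?thesis by (intro mat.expand) auto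
qed

lemma minor_delete: "matroid K \<Longrightarrow> D \<subseteq> ground K \<Longrightarrow> minor (delete K D) K"
  unfolding minor_def using contract_empty by (metis empty_subsetI inf_bot_left)

lemma minor_contract: "matroid K \<Longrightarrow> C \<subseteq> ground K \<Longrightarrow> minor (contract K C) K"
  unfolding minor_def by (rule exI[of _ C], rule exI[of _ "{}"]) (auto simp: delete_def contract_def)

lemma proper_minor_delete: "matroid K \<Longrightarrow> e \<in> ground K \<Longrightarrow> proper_minor (delete K {e}) K"
  unfolding proper_minor_def
  by (rule exI[of _ "{}"], rule exI[of _ "{e}"]) (auto simp: contract_empty)

lemma proper_minor_contract: "matroid K \<Longrightarrow> e \<in> ground K \<Longrightarrow> proper_minor (contract K {e}) K"
  unfolding proper_minor_def
  by (rule exI[of _ "{e}"], rule exI[of _ "{}"]) (auto simp: delete_def contract_def)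

text \<open>Moves one contracted or deleted element to the front. As a natural class is closed under
  minors, the theorem thereby reduces to single-element deletions and contractions.\<close>

lemma proper_minor_cases:
  assumes K: "matroid K" and m: "proper_minor K' K"
  obtains e where "e \<in> ground K" "minor K' (delete K {e}) \<or> minor K' (contract K {e})"
proof -
  obtain C D where CD: "C \<subseteq> ground K" "D \<subseteq> ground K" "C \<inter> D = {}" "C \<union> D \<noteq> {}"
    "K' = delete (contract K C) D"
    using m by (auto simp: proper_minor_def)
  consider e where "e \<in> C" | e where "e \<in> D" using CD by blast
  then show ?thesis
  proof cases
    case 1
    have "contract K C = contract (contract K {e}) (C - {e})"
      using contract_insert[OF K, of e "C - {e}"] 1 by (simp add: insert_absorb)
    then have "minor K' (contract K {e})"
      unfolding minor_def using CD 1
      by (intro exI[of _ "C - {e}"] exI[of _ D]) auto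
    then show ?thesis using that 1 CD by blast
  next
    case 2
    have "K' = delete (contract (delete K {e}) C) (D - {e})"
      using CD 2 by (subst contract_delete) (auto simp: delete_delete insert_absorb)
    then have "minor K' (delete K {e})"
      unfolding minor_def using CD 2
      by (intro exI[of _ C] exI[of _ "D - {e}"]) auto
    then show ?thesis using that 2 CD by blast
  qed
qed

subsection \<open>Principal extensions\<close>

text \<open>An explicit model of the principal extension. \<open>S\<close> is any spanning set of
  the flat rather than the flat itself, so that \<open>x\<close> has few specialisations: only two
  when the flat is spanned by two elements.\<close>

definition free_ext :: "'a mat \<Rightarrow> 'a set \<Rightarrow> 'a \<Rightarrow> 'a mat" where
  "free_ext K S x = Mat (insert x (ground K))
     (indeps K \<union> {insert x I | I. \<exists>f\<in>S. f \<notin> I \<and> insert f I \<in> indeps K})"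

lemma ground_free_ext [simp]: "ground (free_ext K S x) = insert x (ground K)"
  by (simp add: free_ext_def)

text \<open>The requirement \<open>f \<notin> I\<close> makes the exchange of \<open>x\<close> for
  \<open>f\<close> preserve the size of the set.\<close>

lemma indeps_free_ext:
  assumes "matroid K" "S \<subseteq> ground K" "x \<notin> ground K"
  shows "I \<in> indeps (free_ext K S x) \<longleftrightarrow>
    (if x \<in> I then \<exists>f\<in>S. f \<notin> I \<and> insert f (I - {x}) \<in> indeps K else I \<in> indeps K)"
proof (cases "x \<in> I")
  case True
  then have "I \<notin> indeps K" using assms indep_ground by blast
  moreover have "(\<exists>J. I = insert x J \<and> (\<exists>f\<in>S. f \<notin> J \<and> insert f J \<in> indeps K)) \<longleftrightarrow>
    (\<exists>f\<in>S. f \<notin> I \<and> insert f (I - {x}) \<in> indeps K)" (is "?l \<longleftrightarrow> ?r")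
  proof
    assume ?l
    then obtain J f where J: "I = insert x J" "f \<in> S" "f \<notin> J" "insert f J \<in> indeps K" by blast
    moreover have "x \<notin> J" "f \<noteq> x" using indep_ground[OF assms(1) J(4)] J(2) assms by auto
    ultimately show ?r by auto
  next
    assume ?r then show ?l using True by (intro exI[of _ "I - {x}"]) auto
  qed
  ultimately show ?thesis using True by (simp add: free_ext_def)
next
  case False then show ?thesis by (auto simp: free_ext_def)
qed

text \<open>The delicate axiom is augmentation. A set containing \<open>x\<close> is replaced by a
  set of \<open>K\<close> of the same size in which \<open>x\<close> is specialised; when both sets
  contain \<open>x\<close>, with possibly different specialisations \<open>f\<close> and
  \<open>g\<close>, a chain of augmentations is needed.\<close>

lemma matroid_free_ext:
  assumes K: "matroid K" and S: "S \<subseteq> ground K" and x: "x \<notin> ground K"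
  shows "matroid (free_ext K S x)"
proof -
  note ind = indeps_free_ext[OF assms]
  let ?K = "free_ext K S x"
  have fin: "finite I" if I: "I \<in> indeps ?K" for I
  proof (cases "x \<in> I")
    case True
    then obtain f where "insert f (I - {x}) \<in> indeps K" using I ind by auto
    then have "finite (insert f (I - {x}))" by (rule indep_finite[OF K])
    then show ?thesis by simp
  next
    case False then show ?thesis using I ind indep_finite[OF K] by simp
  qed
  have aug: "\<exists>e\<in>J - I. insert e I \<in> indeps ?K"
    if I: "I \<in> indeps ?K" and J: "J \<in> indeps ?K" and c: "card I < card J" for I J
  proof (cases "x \<in> I"; cases "x \<in> J")
    assume xI: "x \<in> I" and xJ: "x \<in> J"
    obtain f where f: "f \<in> S" "f \<notin> I" "insert f (I - {x}) \<in> indeps K" using I xI ind by auto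
    obtain g where g: "g \<in> S" "g \<notin> J" "insert g (J - {x}) \<in> indeps K" using J xJ ind by auto
    let ?I = "I - {x}" and ?J = "J - {x}"
    have c': "card ?I < card ?J" using c xI xJ fin[OF I] fin[OF J]
      by (metis Suc_less_eq card.remove)
    have cf: "card (insert f ?I) = Suc (card ?I)" using fin[OF I] f by simp
    have cg: "card (insert g ?J) = Suc (card ?J)" using fin[OF J] g by simp
    have iI: "?I \<in> indeps K" using indep_subset[OF K f(3)] by blast
    have iJ: "?J \<in> indeps K" using indep_subset[OF K g(3)] by blast
    show ?thesis
    proof (cases "\<exists>e\<in>?J - insert f ?I. insert e (insert f ?I) \<in> indeps K")
      case True
      then obtain e where e: "e \<in> ?J" "e \<notin> insert f ?I" "insert e (insert f ?I) \<in> indeps K" by auto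
      then have "insert e I \<in> indeps ?K"
        using f xI unfolding ind by (auto intro!: bexI[of _ f] simp: insert_Diff_if insert_commute)
      then show ?thesis using e by auto
    next
      \<comment> \<open>Adding first \<open>e\<close> and then \<open>d\<close> to
        \<open>I - {x}\<close> gives a set larger than \<open>insert f (I - {x})\<close>. If
        \<open>d\<close> came from \<open>J\<close>, the latter could be augmented by
        \<open>d\<close> or \<open>e\<close>, contrary to the case assumption. So
        \<open>d = g\<close>, and \<open>g\<close> is the specialisation of \<open>x\<close> that
        makes \<open>insert e I\<close> independent.\<close>
      case False
      obtain e where e: "e \<in> ?J" "e \<notin> ?I" "insert e ?I \<in> indeps K"
        using indep_augment[OF K iI iJ c'] .
      have "card (insert e ?I) = Suc (card ?I)" using fin[OF I] e by simp
      then obtain d where d: "d \<in> insert g ?J" "d \<notin> insert e ?I" "insert d (insert e ?I) \<in> indeps K"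
        using indep_augment[OF K e(3) g(3)] c' cg by auto
      have "d = g"
      proof (rule ccontr)
        assume "d \<noteq> g"
        then have dJ: "d \<in> ?J" using d by blast
        have "card (insert f ?I) < card (insert d (insert e ?I))"
          using cf d e fin[OF I] by simp
        then obtain h where h: "h \<in> insert d (insert e ?I)" "h \<notin> insert f ?I" "insert h (insert f ?I) \<in> indeps K"
          using indep_augment[OF K f(3) d(3)] by blast
        then have "h \<in> ?J - insert f ?I" using dJ e by auto
        then show False using False h by blast
      qed
      moreover have "g \<noteq> x" using g xJ by blast
      ultimately have "insert e I \<in> indeps ?K"
        using d g xI e unfolding ind by (auto intro!: bexI[of _ g] simp: insert_Diff_if)
      then show ?thesis using e by auto
    qed
  next
    assume xI: "x \<in> I" and xJ: "x \<notin> J"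
    obtain f where f: "f \<in> S" "f \<notin> I" "insert f (I - {x}) \<in> indeps K" using I xI ind by auto
    have J: "J \<in> indeps K" using J xJ ind by auto
    have "card (insert f (I - {x})) = card I" using fin[OF I] f xI
      by (metis Diff_iff card.remove card_insert_disjoint finite_Diff)
    then obtain e where e: "e \<in> J" "e \<notin> insert f (I - {x})" "insert e (insert f (I - {x})) \<in> indeps K"
      using indep_augment[OF K f(3) J] c by auto
    have "e \<noteq> x" using e xJ by auto
    then have "insert e I \<in> indeps ?K"
      using f xI e unfolding ind by (auto intro!: bexI[of _ f] simp: insert_Diff_if insert_commute)
    then show ?thesis using e \<open>e \<noteq> x\<close> by auto
  next
    assume xI: "x \<notin> I" and xJ: "x \<in> J"
    obtain g where g: "g \<in> S" "g \<notin> J" "insert g (J - {x}) \<in> indeps K" using J xJ ind by auto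
    have I': "I \<in> indeps K" using I xI ind by auto
    have "card (insert g (J - {x})) = card J" using fin[OF J] g xJ
      by (metis Diff_iff card.remove card_insert_disjoint finite_Diff)
    then obtain e where e: "e \<in> insert g (J - {x})" "e \<notin> I" "insert e I \<in> indeps K"
      using indep_augment[OF K I' g(3)] c by auto
    show ?thesis
    proof (cases "e \<in> J")
      case True
      then have "e \<noteq> x" using e S g x by auto
      then show ?thesis using True e xI by (intro bexI[of _ e]) (auto simp: ind)
    next
      case False
      \<comment> \<open>The element gained is the specialisation of \<open>x\<close>, so
        \<open>x\<close> itself can be added to \<open>I\<close>.\<close>
      then have "e = g" using e by auto
      then have "insert x I \<in> indeps ?K" using e g xI unfolding ind using S x by auto
      then show ?thesis using xJ xI by auto
    qed
  next
    assume xI: "x \<notin> I" and xJ: "x \<notin> J"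
    then obtain e where e: "e \<in> J" "e \<notin> I" "insert e I \<in> indeps K"
      using indep_augment[OF K] I J c ind by metis
    then have "e \<noteq> x" using xJ by auto
    then show ?thesis using e xI by (intro bexI[of _ e]) (auto simp: ind)
  qed
  have sub: "I \<in> indeps ?K" if J: "J \<in> indeps ?K" and IJ: "I \<subseteq> J" for I J
  proof (cases "x \<in> J")
    case True
    then obtain f where f: "f \<in> S" "f \<notin> J" "insert f (J - {x}) \<in> indeps K" using J ind by auto
    have "insert f (I - {x}) \<in> indeps K" "I - {x} \<in> indeps K"
      by (rule indep_subset[OF K f(3)], use IJ in blast)+
    then show ?thesis unfolding ind using f IJ by auto
  next
    case False
    then have "J \<in> indeps K" "x \<notin> I" using J IJ by (auto simp: ind)
    then show ?thesis using indep_subset[OF K _ IJ] by (simp add: ind)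
  qed
  have "indeps ?K \<subseteq> Pow (ground ?K)"
    using indep_ground[OF K] by (fastforce simp: free_ext_def)
  moreover have "finite (ground ?K)" "{} \<in> indeps ?K"
    using matroid_finite[OF K] indep_empty[OF K] by (simp_all add: ind)
  ultimately show ?thesis
    unfolding matroid_def using aug sub by blast
qed

lemma delete_free_ext:
  assumes "matroid K" "S \<subseteq> ground K" "x \<notin> ground K"
  shows "delete (free_ext K S x) {x} = K"
  using assms(3) indep_ground[OF assms(1)]
  by (intro mat.expand) (auto simp: indeps_free_ext[OF assms])

text \<open>With \<open>B\<close> a basis of \<open>T\<close>, the set \<open>T\<close> fails to
  span \<open>x\<close> exactly when some element of \<open>S\<close> extends \<open>B\<close>, that
  is, when \<open>S\<close> is not contained in the closure of \<open>T\<close>.\<close>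

lemma principal_extension_free_ext:
  assumes K: "matroid K" and S: "S \<subseteq> ground K" and x: "x \<notin> ground K"
  shows "principal_extension K (cl K S) x (free_ext K S x)"
  unfolding principal_extension_def
proof (intro conjI allI impI)
  note ind = indeps_free_ext[OF assms]
  fix T assume T: "T \<subseteq> ground K"
  obtain B where B: "basis_of K T B" using basis_of_exists[OF K] .
  have xB: "x \<notin> B" using indep_ground[OF K] basis_ofD[OF B] x by blast
  have B': "basis_of (free_ext K S x) T B"
    by (rule basis_ofI[OF matroid_free_ext[OF assms]])
       (use basis_ofD[OF B] basis_of_maximal[OF B] xB T x in \<open>auto simp: ind\<close>)
  have "x \<in> cl (free_ext K S x) T \<longleftrightarrow> \<not> (\<exists>f\<in>S. f \<notin> B \<and> insert f B \<in> indeps K)"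
    using cl_iff_basis[OF matroid_free_ext[OF assms] B', of x] xB x S by (auto simp: ind)
  also have "\<dots> \<longleftrightarrow> S \<subseteq> cl K T"
    using cl_iff_basis[OF K B] S by blast
  finally show "spans (free_ext K S x) T {x} \<longleftrightarrow> spans K T (cl K S)"
    using cl_subset_cl_iff[OF K S] by (simp add: spans_def)
qed (use matroid_free_ext[OF assms] delete_free_ext[OF assms] in auto)

text \<open>The source of uniqueness for the definite description in \<open>freely_place\<close>:
  \<open>x\<close> extends the independent set \<open>I - {x}\<close> iff it lies outside its
  closure, and this is decided by \<open>K\<close> and \<open>F\<close> alone.\<close>

lemma principal_extension_indeps_iff:
  assumes "principal_extension K F x K'" "x \<notin> ground K"
  shows "I \<in> indeps K' \<longleftrightarrow>
    (if x \<in> I then I - {x} \<in> indeps K \<and> \<not> spans K (I - {x}) F else I \<in> indeps K)"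
proof -
  have K': "matroid K'" and g: "ground K' = insert x (ground K)" and d: "delete K' {x} = K"
    and s: "\<And>S. S \<subseteq> ground K \<Longrightarrow> spans K' S {x} \<longleftrightarrow> spans K S F"
    using assms by (auto simp: principal_extension_def)
  have iK: "J \<in> indeps K \<longleftrightarrow> J \<in> indeps K' \<and> x \<notin> J" for J
    using indeps_delete[of K' "{x}"] d by auto
  show ?thesis
  proof (cases "x \<in> I")
    case True
    have "I \<in> indeps K' \<longleftrightarrow> I - {x} \<in> indeps K' \<and> x \<notin> cl K' (I - {x})"
    proof (cases "I - {x} \<in> indeps K'")
      case i: True
      show ?thesis using cl_indep_iff[OF K' i, of x] True g i by (auto simp: insert_absorb)
    next
      case False
      then show ?thesis using indep_subset[OF K', of I "I - {x}"] by auto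
    qed
    moreover have "x \<notin> cl K' (I - {x}) \<longleftrightarrow> \<not> spans K (I - {x}) F" if "I - {x} \<in> indeps K'"
    proof -
      have "I - {x} \<subseteq> ground K" using indep_ground[OF K' that] g by auto
      from s[OF this] show ?thesis by (auto simp: spans_def)
    qed
    ultimately show ?thesis using True iK by auto
  next
    case False then show ?thesis using iK by auto
  qed
qed

lemma freely_place_cl:
  assumes "matroid K" "S \<subseteq> ground K" "x \<notin> ground K"
  shows "freely_place K (cl K S) x = free_ext K S x"
  unfolding freely_place_def
proof (rule the_equality)
  show pe: "principal_extension K (cl K S) x (free_ext K S x)"
    by (rule principal_extension_free_ext[OF assms])
  fix K' assume pe': "principal_extension K (cl K S) x K'"
  show "K' = free_ext K S x"
  proof (rule mat.expand, intro conjI)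
    show "ground K' = ground (free_ext K S x)" using pe' by (simp add: principal_extension_def)
    show "indeps K' = indeps (free_ext K S x)"
      using principal_extension_indeps_iff[OF pe assms(3)]
        principal_extension_indeps_iff[OF pe' assms(3)] by blast
  qed
qed

section \<open>Direct sums\<close>

lemma ground_direct_sum [simp]: "ground (direct_sum K K') = ground K \<union> ground K'"
  by (simp add: direct_sum_def)

lemma indeps_direct_sum:
  assumes "matroid K" "matroid K'" "ground K \<inter> ground K' = {}"
  shows "I \<in> indeps (direct_sum K K') \<longleftrightarrow>
    I \<subseteq> ground K \<union> ground K' \<and> I \<inter> ground K \<in> indeps K \<and> I \<inter> ground K' \<in> indeps K'"
proof
  assume "I \<in> indeps (direct_sum K K')"
  then obtain X Y where I: "I = X \<union> Y" "X \<in> indeps K" "Y \<in> indeps K'"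
    by (auto simp: direct_sum_def)
  moreover have "X \<subseteq> ground K" "Y \<subseteq> ground K'" using I indep_ground assms by metis+
  moreover have "I \<inter> ground K = X" "I \<inter> ground K' = Y" using calculation assms(3) by auto
  ultimately show "I \<subseteq> ground K \<union> ground K' \<and> I \<inter> ground K \<in> indeps K \<and> I \<inter> ground K' \<in> indeps K'"
    by auto
next
  assume I: "I \<subseteq> ground K \<union> ground K' \<and> I \<inter> ground K \<in> indeps K \<and> I \<inter> ground K' \<in> indeps K'"
  then have "I = (I \<inter> ground K) \<union> (I \<inter> ground K')" by auto
  with I show "I \<in> indeps (direct_sum K K')" by (auto simp: direct_sum_def)
qed

lemma matroid_direct_sum:
  assumes K: "matroid K" and K': "matroid K'" and dj: "ground K \<inter> ground K' = {}"
  shows "matroid (direct_sum K K')"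
  unfolding matroid_def
proof (intro conjI allI ballI impI)
  note ind = indeps_direct_sum[OF assms]
  show "finite (ground (direct_sum K K'))" using matroid_finite[OF K] matroid_finite[OF K'] by simp
  show "indeps (direct_sum K K') \<subseteq> Pow (ground (direct_sum K K'))" using ind by auto
  show "{} \<in> indeps (direct_sum K K')" using ind indep_empty[OF K] indep_empty[OF K'] by auto
  show "I \<in> indeps (direct_sum K K')" if "J \<in> indeps (direct_sum K K')" "I \<subseteq> J" for I J
    using that indep_subset[OF K, of "J \<inter> ground K" "I \<inter> ground K"]
      indep_subset[OF K', of "J \<inter> ground K'" "I \<inter> ground K'"] by (auto simp: ind)
  fix I J assume I: "I \<in> indeps (direct_sum K K')" and J: "J \<in> indeps (direct_sum K K')"
    and c: "card I < card J"
  have split: "card W = card (W \<inter> ground K) + card (W \<inter> ground K')"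
    if "W \<in> indeps (direct_sum K K')" for W
  proof -
    have W: "W = (W \<inter> ground K) \<union> (W \<inter> ground K')" using that ind by auto
    have "card ((W \<inter> ground K) \<union> (W \<inter> ground K')) = card (W \<inter> ground K) + card (W \<inter> ground K')"
      by (rule card_Un_disjoint) (use matroid_finite[OF K] matroid_finite[OF K'] dj in auto)
    then show ?thesis using W by simp
  qed
  consider "card (I \<inter> ground K) < card (J \<inter> ground K)" | "card (I \<inter> ground K') < card (J \<inter> ground K')"
    using split[OF I] split[OF J] c by linarith
  then show "\<exists>e\<in>J - I. insert e I \<in> indeps (direct_sum K K')"
  proof cases
    case 1
    then obtain e where e: "e \<in> J \<inter> ground K" "e \<notin> I \<inter> ground K" "insert e (I \<inter> ground K) \<in> indeps K"
      using indep_augment[OF K] I J ind by metis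
    then have "e \<notin> ground K'" using dj by blast
    then show ?thesis using e I by (intro bexI[of _ e]) (auto simp: ind)
  next
    case 2
    then obtain e where e: "e \<in> J \<inter> ground K'" "e \<notin> I \<inter> ground K'" "insert e (I \<inter> ground K') \<in> indeps K'"
      using indep_augment[OF K'] I J ind by metis
    then have "e \<notin> ground K" using dj by blast
    then show ?thesis using e I by (intro bexI[of _ e]) (auto simp: ind)
  qed
qed

section \<open>Relabelling and the shifted matroid\<close>

lemma ground_relabel [simp]: "ground (relabel f K) = f ` ground K"
  and indeps_relabel [simp]: "indeps (relabel f K) = (`) f ` indeps K"
  by (auto simp: relabel_def)

lemma indeps_relabel_iff:
  assumes "matroid K" "inj_on f (ground K)" "S \<subseteq> ground K"
  shows "f ` S \<in> indeps (relabel f K) \<longleftrightarrow> S \<in> indeps K"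
  using assms indep_ground[OF assms(1)] by (auto simp: inj_on_image_eq_iff)

lemma matroid_relabel:
  assumes K: "matroid K" and f: "inj_on f (ground K)"
  shows "matroid (relabel f K)"
  unfolding matroid_def
proof (intro conjI allI ballI impI)
  show "finite (ground (relabel f K))" using matroid_finite[OF K] by simp
  show "indeps (relabel f K) \<subseteq> Pow (ground (relabel f K))" using indep_ground[OF K] by auto
  show "{} \<in> indeps (relabel f K)" using indep_empty[OF K] by auto
  show "I \<in> indeps (relabel f K)" if "J \<in> indeps (relabel f K)" "I \<subseteq> J" for I J
    using that indep_subset[OF K] by (auto simp: subset_image_iff)
  fix I J assume "I \<in> indeps (relabel f K)" "J \<in> indeps (relabel f K)" and c: "card I < card J"
  then obtain X Y where X: "I = f ` X" "X \<in> indeps K" and Y: "J = f ` Y" "Y \<in> indeps K" by auto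
  have "card I = card X" "card J = card Y"
    using X Y f indep_ground[OF K] by (auto intro!: card_image intro: inj_on_subset)
  with c obtain e where e: "e \<in> Y" "e \<notin> X" "insert e X \<in> indeps K"
    using indep_augment[OF K X(2) Y(2)] by auto
  have "f e \<notin> f ` X"
    using e f indep_ground[OF K e(3)] by (metis inj_on_image_mem_iff insert_subset)
  then show "\<exists>d\<in>J - I. insert d I \<in> indeps (relabel f K)"
    using e X Y by (intro bexI[of _ "f e"]) (auto simp: image_iff intro!: bexI[of _ "insert e X"])
qed

lemma isomorphic_relabel:
  assumes "matroid K" "inj_on f (ground K)"
  shows "isomorphic K (relabel f K)"
  unfolding isomorphic_def using indeps_relabel_iff[OF assms] assms(2)
  by (intro exI[of _ f]) (auto simp: bij_betw_def)

text \<open>The new \<open>p\<close> is a generic point of the flat spanned by the old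
  \<open>p\<close> and \<open>q\<close>, hence specialises to either of them. The arbitrary choice
  of \<open>c\<close> disappears from this description.\<close>

lemma shift_characterization:
  assumes inf: "infinite (UNIV :: 'a set)" and L: "matroid (L :: 'a mat)"
    and p: "p \<in> ground L" and q: "q \<in> ground L" and pq: "p \<noteq> q"
  shows "matroid (shift L p q)" "ground (shift L p q) = ground L"
    "W \<in> indeps (shift L p q) \<longleftrightarrow>
      W \<in> indeps L \<or> p \<in> W \<and> q \<notin> W \<and> insert q (W - {p}) \<in> indeps L"
proof -
  define c where "c = (SOME c. c \<notin> ground L)"
  have c: "c \<notin> ground L"
    unfolding c_def using ex_new_if_finite[OF inf matroid_finite[OF L]] by (rule someI_ex)
  have pqL: "{p, q} \<subseteq> ground L" using p q by auto
  define K where "K = free_ext L {p, q} c"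
  note ind = indeps_free_ext[OF L pqL c, folded K_def]
  have K: "matroid K" unfolding K_def by (rule matroid_free_ext[OF L pqL c])
  have gK: "ground K = insert c (ground L)" by (simp add: K_def)
  let ?f = "id(c := p)"
  have sh: "shift L p q = relabel ?f (delete K {p})"
    by (simp add: shift_def c_def[symmetric] Let_def K_def freely_place_cl[OF L pqL c])
  have K': "matroid (delete K {p})" by (rule matroid_delete[OF K])
  have inj: "inj_on ?f (ground (delete K {p}))" using c p by (auto simp: inj_on_def gK)
  show "matroid (shift L p q)" unfolding sh by (rule matroid_relabel[OF K' inj])
  show g: "ground (shift L p q) = ground L"
    unfolding sh using c p by (auto simp: gK)
  show "W \<in> indeps (shift L p q) \<longleftrightarrow>
      W \<in> indeps L \<or> p \<in> W \<and> q \<notin> W \<and> insert q (W - {p}) \<in> indeps L"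
  proof (cases "W \<subseteq> ground L")
    case False
    have "W \<notin> indeps (shift L p q)"
      using False g indep_ground[OF \<open>matroid (shift L p q)\<close>] by blast
    moreover have "W \<subseteq> ground L" if "insert q (W - {p}) \<in> indeps L"
      using indep_ground[OF L that] p by auto
    ultimately show ?thesis using False indep_ground[OF L] by blast
  next
    case True
    \<comment> \<open>\<open>V\<close> is the preimage of \<open>W\<close> under the relabelling:
      \<open>p\<close> in \<open>W\<close> stands for \<open>c\<close>, since the original
      \<open>p\<close> has been deleted.\<close>
    define V where "V = (if p \<in> W then insert c (W - {p}) else W)"
    have V: "?f ` V = W" "V \<subseteq> ground (delete K {p})"
      using True c p by (auto simp: V_def gK)
    have "W \<in> indeps (shift L p q) \<longleftrightarrow> V \<in> indeps (delete K {p})"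
      using indeps_relabel_iff[OF K' inj V(2)] V(1) sh by simp
    also have "\<dots> \<longleftrightarrow> V \<in> indeps K" using V(2) by auto
    also have "\<dots> \<longleftrightarrow> W \<in> indeps L \<or> p \<in> W \<and> q \<notin> W \<and> insert q (W - {p}) \<in> indeps L"
    proof (cases "p \<in> W")
      case pW: True
      have e: "insert c (W - {p}) - {c} = W - {p}" using True c by auto
      have "p \<noteq> c" "q \<noteq> c" using p q c by auto
      then show ?thesis using pW pq by (auto simp: V_def ind e insert_absorb)
    next
      case False
      then show ?thesis using True c by (auto simp: V_def ind)
    qed
    finally show ?thesis .
  qed
qed

text \<open>Each \<open>nw x\<close> specialises to \<open>x\<close> or to \<open>c\<close>. The
  element \<open>c\<close> can be taken only once, and only if it is not already in
  \<open>W\<close>; hence either every \<open>nw x\<close> goes to its \<open>x\<close> or exactly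
  one goes to \<open>c\<close>.\<close>

lemma fold_freely_place:
  fixes c :: 'a and nw :: "'a \<Rightarrow> 'a"
  defines "st \<equiv> \<lambda>x K. freely_place K (cl K {x, c}) (nw x)"
  assumes K: "matroid K" and "distinct xs" "insert c (set xs) \<subseteq> ground K" "c \<notin> set xs"
    "inj_on nw (set xs)" "nw ` set xs \<inter> ground K = {}"
  shows "matroid (fold st xs K) \<and> ground (fold st xs K) = ground K \<union> nw ` set xs \<and>
    (\<forall>W X. W \<subseteq> ground K \<longrightarrow> X \<subseteq> set xs \<longrightarrow> W \<inter> X = {} \<longrightarrow>
      (W \<union> nw ` X \<in> indeps (fold st xs K) \<longleftrightarrow>
        W \<union> X \<in> indeps K \<or> c \<notin> W \<and> (\<exists>x\<in>X. insert c (W \<union> (X - {x})) \<in> indeps K)))"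
  using assms(3-)
proof (induction xs rule: rev_induct)
  case Nil
  show ?case using K by auto
next
  case (snoc x xs)
  define K1 where "K1 = fold st xs K"
  have IH: "matroid K1" "ground K1 = ground K \<union> nw ` set xs"
    and IHi: "\<And>W X. W \<subseteq> ground K \<Longrightarrow> X \<subseteq> set xs \<Longrightarrow> W \<inter> X = {} \<Longrightarrow>
      W \<union> nw ` X \<in> indeps K1 \<longleftrightarrow>
        W \<union> X \<in> indeps K \<or> c \<notin> W \<and> (\<exists>x\<in>X. insert c (W \<union> (X - {x})) \<in> indeps K)"
    using snoc unfolding K1_def by auto
  have S: "{x, c} \<subseteq> ground K1" using snoc.prems IH by auto
  have n: "nw x \<notin> ground K1" using snoc.prems IH by auto
  have eq: "fold st (xs @ [x]) K = free_ext K1 {x, c} (nw x)"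
    using freely_place_cl[OF IH(1) S n] by (simp add: K1_def st_def)
  show ?case unfolding eq
  proof (intro conjI allI impI)
    show "matroid (free_ext K1 {x, c} (nw x))" by (rule matroid_free_ext[OF IH(1) S n])
    show "ground (free_ext K1 {x, c} (nw x)) = ground K \<union> nw ` set (xs @ [x])" using IH by auto
    fix W X assume W: "W \<subseteq> ground K" and X: "X \<subseteq> set (xs @ [x])" and WX: "W \<inter> X = {}"
    note ind = indeps_free_ext[OF IH(1) S n]
    have xc: "x \<in> ground K" "c \<in> ground K" "x \<noteq> c" "x \<notin> set xs" using snoc.prems by auto
    have nX: "nw ` X \<inter> ground K = {}" using snoc.prems X by blast
    have nx: "nw x \<in> nw ` X \<longleftrightarrow> x \<in> X" using snoc.prems(4) X by (auto simp: inj_on_def)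
    have mem: "nw x \<in> W \<union> nw ` X \<longleftrightarrow> x \<in> X" using nx W snoc.prems by auto
    show "W \<union> nw ` X \<in> indeps (free_ext K1 {x, c} (nw x)) \<longleftrightarrow>
        W \<union> X \<in> indeps K \<or> c \<notin> W \<and> (\<exists>x\<in>X. insert c (W \<union> (X - {x})) \<in> indeps K)"
    proof (cases "x \<in> X")
      case False
      then show ?thesis using IHi[OF W, of X] X WX mem ind by auto
    next
      case True
      let ?X = "X - {x}"
      have X': "?X \<subseteq> set xs" using X by auto
      have rem: "(W \<union> nw ` X) - {nw x} = W \<union> nw ` ?X"
        using True W snoc.prems X by (auto simp: inj_on_def)
      have fx: "x \<notin> W \<union> nw ` X" using True WX nX xc by auto
      have fc: "c \<notin> nw ` X" using nX xc by auto
      \<comment> \<open>The last placed element specialises to \<open>x\<close> or to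
        \<open>c\<close>. Either one joins \<open>W\<close>, and in the second case \<open>c\<close>
        is no longer available to the others.\<close>
      have "W \<union> nw ` X \<in> indeps (free_ext K1 {x, c} (nw x)) \<longleftrightarrow>
        insert x W \<union> nw ` ?X \<in> indeps K1 \<or> c \<notin> W \<and> insert c W \<union> nw ` ?X \<in> indeps K1"
        using mem True fx fc by (simp add: ind rem)
      also have "insert x W \<union> nw ` ?X \<in> indeps K1 \<longleftrightarrow> W \<union> X \<in> indeps K \<or>
        c \<notin> W \<and> (\<exists>y\<in>?X. insert c (W \<union> (X - {y})) \<in> indeps K)"
      proof -
        have "insert x W \<union> nw ` ?X \<in> indeps K1 \<longleftrightarrow> insert x W \<union> ?X \<in> indeps K \<or>
          c \<notin> insert x W \<and> (\<exists>y\<in>?X. insert c (insert x W \<union> (?X - {y})) \<in> indeps K)"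
          by (rule IHi) (use W X' WX xc in auto)
        also have "insert x W \<union> ?X = W \<union> X" using True by auto
        also have "(\<exists>y\<in>?X. insert c (insert x W \<union> (?X - {y})) \<in> indeps K) \<longleftrightarrow>
          (\<exists>y\<in>?X. insert c (W \<union> (X - {y})) \<in> indeps K)"
        proof (rule bex_cong[OF refl])
          fix y assume "y \<in> ?X"
          then have "insert x W \<union> (?X - {y}) = W \<union> (X - {y})" using True by auto
          then show "insert c (insert x W \<union> (?X - {y})) \<in> indeps K \<longleftrightarrow> insert c (W \<union> (X - {y})) \<in> indeps K"
            by (simp only:)
        qed
        finally show ?thesis using xc by simp
      qed
      also have "insert c W \<union> nw ` ?X \<in> indeps K1 \<longleftrightarrow> insert c (W \<union> (X - {x})) \<in> indeps K"
        using IHi[of "insert c W" ?X] W X' WX xc snoc.prems by auto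
      finally show ?thesis using True by auto
    qed
  qed
qed

subsection \<open>Independent sets of the construction\<close>

text \<open>
  For a set \<open>I\<close>, \<open>P\<close> is the part of \<open>I \<inter> A\<close> whose elements $x_a$ are specialised to \<open>x\<close>, and \<open>\<alpha>\<close>
  records whether \<open>a\<close> is then present, either as an element of \<open>I\<close> or as the specialisation of
  the one remaining $x_a$; in this case \<open>placed\<close> further specialises \<open>a\<close> to some \<open>f \<in> F\<close>.
\<close>

definition pick :: "'a set \<Rightarrow> 'a \<Rightarrow> 'a set \<Rightarrow> 'a set \<Rightarrow> bool \<Rightarrow> bool" where
  "pick A a I P \<alpha> \<longleftrightarrow>
     P = I \<inter> A \<and> (\<alpha> \<longleftrightarrow> a \<in> I) \<or> a \<notin> I \<and> \<alpha> \<and> (\<exists>x\<in>I \<inter> A. P = I \<inter> A - {x})"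

definition placed :: "'a set \<Rightarrow> bool \<Rightarrow> 'a set \<Rightarrow> bool" where
  "placed F \<alpha> R \<longleftrightarrow> (if \<alpha> then \<exists>f\<in>F. R = {f} else R = {})"

definition selection :: "'a set \<Rightarrow> 'a set \<Rightarrow> 'a \<Rightarrow> 'a set \<Rightarrow> 'a set \<Rightarrow> 'a set \<Rightarrow> bool" where
  "selection F A a I P R \<longleftrightarrow> (\<exists>\<alpha>. pick A a I P \<alpha> \<and> placed F \<alpha> R)"

lemma pick_subset: "pick A a I P \<alpha> \<Longrightarrow> P \<subseteq> I \<inter> A"
  by (auto simp: pick_def)

text \<open>Brings the choice made by \<open>pick\<close> into the two-way form produced by
  \<open>fold_freely_place\<close>.\<close>

lemma ex_pick_iff:
  "(\<exists>P \<alpha>. pick A a I P \<alpha> \<and> \<phi> P \<alpha>) \<longleftrightarrow>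
     \<phi> (I \<inter> A) (a \<in> I) \<or> a \<notin> I \<and> (\<exists>x\<in>I \<inter> A. \<phi> (I \<inter> A - {x}) True)"
  by (cases "a \<in> I") (auto simp: pick_def ex_bool_eq)

lemma ex_placed_iff:
  "(\<exists>R. placed F True R \<and> R \<inter> X = {} \<and> \<phi> R) \<longleftrightarrow> (\<exists>f\<in>F. f \<notin> X \<and> \<phi> {f})"
  by (auto simp: placed_def)

text \<open>These assumptions are stable under replacing \<open>L\<close> by a matroid on a subset
  of its ground set that contains \<open>p\<close> and \<open>q\<close>, and under exchanging the
  roles of \<open>p\<close>, \<open>A\<close>, \<open>a\<close> and \<open>q\<close>,
  \<open>B\<close>, \<open>b\<close>. The locale is instantiated anew for shifts, for minors of
  \<open>L\<close> and for the exchanged roles.\<close>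

locale construction =
  fixes L N :: "'a mat" and p q :: 'a and A B :: "'a set" and xs ys :: "'a list"
    and a b :: 'a and nw :: "'a \<Rightarrow> 'a"
  assumes L: "matroid L" and N: "matroid N" and NL: "ground N \<inter> ground L = {}"
    and p: "p \<in> ground L" and q: "q \<in> ground L" and pq: "p \<noteq> q"
    and AB: "A \<union> B = ground N" "A \<inter> B = {}"
    and xs: "distinct xs" "set xs = A" and ys: "distinct ys" "set ys = B"
    and fresh: "fresh_labels L N a b nw"
begin

lemma labels:
  "a \<noteq> b" "a \<notin> ground N" "a \<notin> ground L" "b \<notin> ground N" "b \<notin> ground L"
  using fresh by (auto simp: fresh_labels_def)

lemma nw_inj: "inj_on nw (ground N)"
  using fresh by (auto simp: fresh_labels_def)

lemma nw_new:
  assumes "x \<in> ground N"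
  shows "nw x \<notin> ground N" "nw x \<notin> ground L" "nw x \<noteq> a" "nw x \<noteq> b"
  using fresh assms by (auto simp: fresh_labels_def)

section \<open>The matroids at the successive stages of the construction\<close>

definition "K0 = direct_sum N L"
definition "Ka = free_ext K0 (insert p (ground N)) a"
definition "Kb = free_ext Ka (insert q (ground N)) b"
definition "KA = fold (\<lambda>x K. freely_place K (cl K {x, a}) (nw x)) xs Kb"
definition "KB = fold (\<lambda>y K. freely_place K (cl K {y, b}) (nw y)) ys KA"

lemma K0: "matroid K0" "ground K0 = ground N \<union> ground L"
  unfolding K0_def using matroid_direct_sum[OF N L NL] by auto

lemma Ka_prems: "insert p (ground N) \<subseteq> ground K0" "a \<notin> ground K0"
  using K0 p labels by auto

lemma Ka: "matroid Ka" "ground Ka = insert a (ground N \<union> ground L)"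
  unfolding Ka_def using matroid_free_ext[OF K0(1) Ka_prems] K0 by auto

lemma Kb_prems: "insert q (ground N) \<subseteq> ground Ka" "b \<notin> ground Ka"
  using Ka q labels by auto

lemma Kb: "matroid Kb" "ground Kb = {a, b} \<union> ground N \<union> ground L"
  unfolding Kb_def using matroid_free_ext[OF Ka(1) Kb_prems] Ka by auto

lemma KA_prems: "insert a (set xs) \<subseteq> ground Kb" "a \<notin> set xs" "inj_on nw (set xs)"
    "nw ` set xs \<inter> ground Kb = {}"
proof -
  have A: "A \<subseteq> ground N" "nw ` A \<subseteq> nw ` ground N" using AB by auto
  show "insert a (set xs) \<subseteq> ground Kb" "a \<notin> set xs" using A Kb xs labels by auto
  show "inj_on nw (set xs)" using inj_on_subset[OF nw_inj] A xs by simp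
  show "nw ` set xs \<inter> ground Kb = {}" unfolding xs Kb using A(1) by (auto dest: nw_new)
qed

lemmas KA_fold = fold_freely_place[OF Kb(1) xs(1) KA_prems, folded KA_def]

lemma KA: "matroid KA" "ground KA = {a, b} \<union> ground N \<union> ground L \<union> nw ` A"
  using KA_fold[THEN conjunct1] KA_fold[THEN conjunct2, THEN conjunct1]
  by (simp_all add: Kb xs)

lemma KB_prems: "insert b (set ys) \<subseteq> ground KA" "b \<notin> set ys" "inj_on nw (set ys)"
    "nw ` set ys \<inter> ground KA = {}"
proof -
  have B: "B \<subseteq> ground N" "nw ` B \<subseteq> nw ` ground N" using AB by auto
  have "nw ` B \<inter> nw ` A = {}"
    using inj_on_image_Int[OF nw_inj, of B A] AB by blast
  then show "nw ` set ys \<inter> ground KA = {}" unfolding ys KA using B(1) by (auto dest: nw_new)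
  show "insert b (set ys) \<subseteq> ground KA" "b \<notin> set ys" using B KA ys labels by auto
  show "inj_on nw (set ys)" using inj_on_subset[OF nw_inj] B ys by simp
qed

lemmas KB_fold = fold_freely_place[OF KA(1) ys(1) KB_prems, folded KB_def]

lemma KB: "matroid KB" "ground KB = {a, b} \<union> ground N \<union> ground L \<union> nw ` ground N"
  using KB_fold[THEN conjunct1] KB_fold[THEN conjunct2, THEN conjunct1]
  by (simp_all add: KA ys AB(1)[symmetric] image_Un Un_assoc)

lemma M1_eq: "M1 L p q N xs ys a b nw = KB"
  unfolding M1_def Let_def KB_def KA_def Kb_def Ka_def K0_def[symmetric]
  by (simp add: freely_place_cl[OF K0(1) Ka_prems] freely_place_cl[OF Ka(1) Kb_prems, unfolded Ka_def])

abbreviation "MM \<equiv> M L p q N xs ys a b nw"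

definition "lab z = (if z \<in> nw ` ground N then inv_into (ground N) nw z else z)"

lemma M_eq: "MM = delete (relabel lab (delete KB (ground N))) {p, q}"
  using xs ys AB unfolding M_def M2_def M1_eq lab_def[abs_def] by simp

text \<open>The original elements of \<open>N\<close> have been deleted, so \<open>lab\<close> takes
  a value in \<open>ground N\<close> only on elements named by \<open>nw\<close>. On each of the two
  kinds of element it is injective.\<close>

lemma lab_inj: "inj_on lab (ground (delete KB (ground N)))"
proof (rule inj_onI)
  fix x y assume xy: "x \<in> ground (delete KB (ground N))" "y \<in> ground (delete KB (ground N))" "lab x = lab y"
  have *: "lab z \<in> ground N \<longleftrightarrow> z \<in> nw ` ground N" if "z \<in> ground (delete KB (ground N))" for z
    using that by (simp add: lab_def inv_into_into)
  show "x = y"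
    using *[OF xy(1)] *[OF xy(2)] xy(3) unfolding lab_def
    by (metis f_inv_into_f)
qed

lemma matroid_relabelled: "matroid (relabel lab (delete KB (ground N)))"
  by (rule matroid_relabel[OF matroid_delete[OF KB(1)] lab_inj])

lemma matroid_M: "matroid MM"
  unfolding M_eq by (rule matroid_delete[OF matroid_relabelled])

lemma lab_nw: "x \<in> ground N \<Longrightarrow> lab (nw x) = x"
  using nw_inj by (simp add: lab_def)

lemma lab_other: "z \<notin> nw ` ground N \<Longrightarrow> lab z = z"
  by (simp add: lab_def)

lemma lab_image_nw: "X \<subseteq> ground N \<Longrightarrow> lab ` nw ` X = X"
  using lab_nw by (force simp: image_image)

lemma lab_image_other: "X \<inter> nw ` ground N = {} \<Longrightarrow> lab ` X = X"
  using lab_other by (force simp: image_def)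

lemma ground_relabelled: "lab ` (ground KB - ground N) = {a, b} \<union> ground N \<union> ground L"
proof -
  have "ground KB - ground N = ({a, b} \<union> ground L) \<union> nw ` ground N"
    unfolding KB using labels NL by (auto dest: nw_new)
  moreover have "lab ` ({a, b} \<union> ground L) = {a, b} \<union> ground L"
    by (rule lab_image_other) (auto dest: nw_new)
  ultimately have "lab ` (ground KB - ground N) = ({a, b} \<union> ground L) \<union> ground N"
    using lab_image_nw[of "ground N"] by (simp only: image_Un)
  then show ?thesis by auto
qed

lemma ground_M: "ground MM = {a, b} \<union> ground N \<union> (ground L - {p, q})"
  unfolding M_eq ground_delete ground_relabel ground_relabelled using p q NL labels by auto

lemma M_indep_KB:
  assumes I: "I \<subseteq> ground MM"
  shows "I \<in> indeps MM \<longleftrightarrow> (I - ground N) \<union> nw ` (I \<inter> ground N) \<in> indeps KB"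
proof -
  let ?J = "(I - ground N) \<union> nw ` (I \<inter> ground N)"
  have J: "?J \<subseteq> ground (delete KB (ground N))"
    using I unfolding ground_M ground_delete KB by (auto dest: nw_new)
  have "(I - ground N) \<inter> nw ` ground N = {}" using I unfolding ground_M by (auto dest: nw_new)
  from lab_image_other[OF this] have "lab ` ?J = (I - ground N) \<union> (I \<inter> ground N)"
    using lab_image_nw[OF Int_lower2[of I "ground N"]] by (simp only: image_Un)
  also have "\<dots> = I" by auto
  finally have "I \<in> indeps MM \<longleftrightarrow> ?J \<in> indeps (delete KB (ground N))"
    using indeps_relabel_iff[OF matroid_delete[OF KB(1)] lab_inj J] I p q NL labels
    unfolding ground_M unfolding M_eq indeps_delete[of "relabel _ _"] by auto
  also have "\<dots> \<longleftrightarrow> ?J \<in> indeps KB" using J by auto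
  finally show ?thesis .
qed

text \<open>The first of four lemmas that undo the placements in reverse order: the copies of
  \<open>B\<close>, the copies of \<open>A\<close>, then \<open>b\<close>, then \<open>a\<close>.
  The set \<open>{z. z = b \<and> \<beta>}\<close> is \<open>{b}\<close> or empty, so the truth
  value \<open>\<beta>\<close> carries the presence of \<open>b\<close>.\<close>

lemma KB_indep_KA:
  assumes "Z \<subseteq> {a, b} \<union> ground L" "I \<inter> ({a, b} \<union> ground L) = Z"
  shows "Z \<union> nw ` (I \<inter> ground N) \<in> indeps KB \<longleftrightarrow>
    (\<exists>Q \<beta>. pick B b I Q \<beta> \<and> (Z - {b}) \<union> nw ` (I \<inter> A) \<union> Q \<union> {z. z = b \<and> \<beta>} \<in> indeps KA)"
proof -
  let ?W = "Z \<union> nw ` (I \<inter> A)"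
  have eq: "Z \<union> nw ` (I \<inter> ground N) = ?W \<union> nw ` (I \<inter> B)" using AB(1) by auto
  have W: "?W \<subseteq> ground KA" using assms KA by auto
  have sub: "A \<subseteq> ground N" "B \<subseteq> ground N" using AB by auto
  have nA: "nw ` (I \<inter> A) \<inter> ground N = {}" "b \<notin> nw ` (I \<inter> A)"
    using sub(1) nw_new(1,4) by blast+
  have ZN: "Z \<inter> ground N = {}" using assms(1) labels NL by auto
  have WB: "?W \<inter> (I \<inter> B) = {}" using nA ZN sub by blast
  have bW: "b \<in> ?W \<longleftrightarrow> b \<in> I" using assms nA by auto
  have "Z \<union> nw ` (I \<inter> ground N) \<in> indeps KB \<longleftrightarrow> ?W \<union> (I \<inter> B) \<in> indeps KA \<or>
    b \<notin> I \<and> (\<exists>y\<in>I \<inter> B. insert b (?W \<union> (I \<inter> B - {y})) \<in> indeps KA)"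
    unfolding eq using KB_fold[THEN conjunct2, THEN conjunct2, rule_format, OF W _ WB] ys bW by auto
  also have "\<dots> \<longleftrightarrow> (\<exists>Q \<beta>. pick B b I Q \<beta> \<and> (Z - {b}) \<union> nw ` (I \<inter> A) \<union> Q \<union> {z. z = b \<and> \<beta>} \<in> indeps KA)"
  proof -
    have "Z - {b} \<union> nw ` (I \<inter> A) \<union> (I \<inter> B) \<union> {z. z = b \<and> b \<in> I} = ?W \<union> (I \<inter> B)"
      using assms by auto
    moreover have "Z - {b} \<union> nw ` (I \<inter> A) \<union> X \<union> {z. z = b \<and> True} = insert b (?W \<union> X)" for X
      by auto
    ultimately show ?thesis unfolding ex_pick_iff by (simp only:)
  qed
  finally show ?thesis .
qed

lemma KA_indep_Kb:
  assumes "S \<subseteq> ground L" "Q \<subseteq> B"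
  shows "(S \<union> (I \<inter> {a})) \<union> nw ` (I \<inter> A) \<union> Q \<union> {z. z = b \<and> \<beta>} \<in> indeps KA \<longleftrightarrow>
    (\<exists>P \<alpha>. pick A a I P \<alpha> \<and> S \<union> P \<union> Q \<union> {z. z = a \<and> \<alpha>} \<union> {z. z = b \<and> \<beta>} \<in> indeps Kb)"
proof -
  let ?W = "S \<union> (I \<inter> {a}) \<union> Q \<union> {z. z = b \<and> \<beta>}"
  have eq: "(S \<union> (I \<inter> {a})) \<union> nw ` (I \<inter> A) \<union> Q \<union> {z. z = b \<and> \<beta>} = ?W \<union> nw ` (I \<inter> A)" by auto
  have W: "?W \<subseteq> ground Kb" using assms Kb AB by auto
  have sub: "A \<subseteq> ground N" "B \<subseteq> ground N" using AB by auto
  have WA: "?W \<inter> (I \<inter> A) = {}" using assms labels NL AB(2) sub by auto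
  have aW: "a \<in> ?W \<longleftrightarrow> a \<in> I" using assms labels sub by auto
  have "?W \<union> nw ` (I \<inter> A) \<in> indeps KA \<longleftrightarrow> ?W \<union> (I \<inter> A) \<in> indeps Kb \<or>
    a \<notin> I \<and> (\<exists>x\<in>I \<inter> A. insert a (?W \<union> (I \<inter> A - {x})) \<in> indeps Kb)"
    using KA_fold[THEN conjunct2, THEN conjunct2, rule_format, OF W _ WA] xs aW by auto
  also have "\<dots> \<longleftrightarrow> (\<exists>P \<alpha>. pick A a I P \<alpha> \<and> S \<union> P \<union> Q \<union> {z. z = a \<and> \<alpha>} \<union> {z. z = b \<and> \<beta>} \<in> indeps Kb)"
  proof -
    have "S \<union> (I \<inter> A) \<union> Q \<union> {z. z = a \<and> a \<in> I} \<union> {z. z = b \<and> \<beta>} = ?W \<union> (I \<inter> A)"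
      by auto
    moreover have "S \<union> X \<union> Q \<union> {z. z = a \<and> True} \<union> {z. z = b \<and> \<beta>} = insert a (?W \<union> X)" for X
      by auto
    ultimately show ?thesis unfolding ex_pick_iff by (simp only:)
  qed
  finally show ?thesis unfolding eq .
qed

lemma Kb_indep_Ka:
  assumes "S \<subseteq> ground L - {p, q}" "P \<subseteq> A" "Q \<subseteq> B"
  shows "S \<union> P \<union> Q \<union> {z. z = a \<and> \<alpha>} \<union> {z. z = b \<and> \<beta>} \<in> indeps Kb \<longleftrightarrow>
    (\<exists>T. placed (insert q (ground N)) \<beta> T \<and> T \<inter> (P \<union> Q) = {} \<and> S \<union> P \<union> Q \<union> T \<union> {z. z = a \<and> \<alpha>} \<in> indeps Ka)"
proof -
  let ?W = "S \<union> P \<union> Q \<union> {z. z = a \<and> \<alpha>}"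
  have bW: "b \<notin> ?W" using assms labels AB by auto
  \<comment> \<open>The possible values of \<open>b\<close> lie in
    \<open>insert q (ground N)\<close>, which meets the whole set only inside
    \<open>P \<union> Q\<close>, because \<open>S\<close> lies in \<open>L\<close> and omits
    \<open>q\<close>.\<close>
  have f: "f \<notin> ?W \<union> {b} \<longleftrightarrow> f \<notin> P \<union> Q" if "f \<in> insert q (ground N)" for f
    using that assms labels q NL by blast
  note ind = indeps_free_ext[OF Ka(1) Kb_prems, folded Kb_def]
  show ?thesis
  proof (cases \<beta>)
    case True
    have "?W \<union> {b} \<in> indeps Kb \<longleftrightarrow>
      (\<exists>f\<in>insert q (ground N). f \<notin> ?W \<union> {b} \<and> insert f (?W \<union> {b} - {b}) \<in> indeps Ka)"
      unfolding ind by auto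
    also have "?W \<union> {b} - {b} = ?W" using bW by auto
    also have "(\<exists>f\<in>insert q (ground N). f \<notin> ?W \<union> {b} \<and> insert f ?W \<in> indeps Ka) \<longleftrightarrow>
      (\<exists>f\<in>insert q (ground N). f \<notin> P \<union> Q \<and> insert f ?W \<in> indeps Ka)"
      using f by blast
    also have "\<dots> \<longleftrightarrow> (\<exists>T. placed (insert q (ground N)) \<beta> T \<and> T \<inter> (P \<union> Q) = {} \<and>
      S \<union> P \<union> Q \<union> T \<union> {z. z = a \<and> \<alpha>} \<in> indeps Ka)"
    proof -
      have "S \<union> P \<union> Q \<union> {f} \<union> {z. z = a \<and> \<alpha>} = insert f ?W" for f by auto
      then show ?thesis by (simp only: True ex_placed_iff)
    qed
    finally show ?thesis using True by simp
  next
    case False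
    then show ?thesis using bW labels(1) by (auto simp: placed_def ind)
  qed
qed

lemma Ka_indep_K0:
  assumes "S \<subseteq> ground L - {p, q}" "P \<subseteq> A" "Q \<subseteq> B" "T \<subseteq> insert q (ground N)"
  shows "S \<union> P \<union> Q \<union> T \<union> {z. z = a \<and> \<alpha>} \<in> indeps Ka \<longleftrightarrow>
    (\<exists>R. placed (insert p (ground N)) \<alpha> R \<and> R \<inter> (P \<union> Q \<union> T) = {} \<and> S \<union> P \<union> Q \<union> R \<union> T \<in> indeps K0)"
proof -
  let ?W = "S \<union> P \<union> Q \<union> T"
  have aW: "a \<notin> ?W" using assms labels AB q by auto
  have f: "f \<notin> ?W \<union> {a} \<longleftrightarrow> f \<notin> P \<union> Q \<union> T" if "f \<in> insert p (ground N)" for f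
    using that assms labels p NL by blast
  note ind = indeps_free_ext[OF K0(1) Ka_prems, folded Ka_def]
  show ?thesis
  proof (cases \<alpha>)
    case True
    have "?W \<union> {a} \<in> indeps Ka \<longleftrightarrow>
      (\<exists>f\<in>insert p (ground N). f \<notin> ?W \<union> {a} \<and> insert f (?W \<union> {a} - {a}) \<in> indeps K0)"
      unfolding ind by auto
    also have "?W \<union> {a} - {a} = ?W" using aW by auto
    also have "(\<exists>f\<in>insert p (ground N). f \<notin> ?W \<union> {a} \<and> insert f ?W \<in> indeps K0) \<longleftrightarrow>
      (\<exists>f\<in>insert p (ground N). f \<notin> P \<union> Q \<union> T \<and> insert f ?W \<in> indeps K0)"
      using f by blast
    also have "\<dots> \<longleftrightarrow> (\<exists>R. placed (insert p (ground N)) \<alpha> R \<and> R \<inter> (P \<union> Q \<union> T) = {} \<and>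
      S \<union> P \<union> Q \<union> R \<union> T \<in> indeps K0)"
    proof -
      have "S \<union> P \<union> Q \<union> {f} \<union> T = insert f ?W" for f by auto
      then show ?thesis by (simp only: True ex_placed_iff)
    qed
    finally show ?thesis using True by simp
  next
    case False
    then show ?thesis using aW by (simp add: placed_def ind)
  qed
qed

end

text \<open>\<open>P\<close> and \<open>Q\<close> are the elements of \<open>A\<close> and
  \<open>B\<close> that keep their names; \<open>R\<close> and \<open>T\<close> hold the
  specialisations of \<open>a\<close> and \<open>b\<close>, at most one element each. The
  disjointness conditions preserve the size of the set, and independence in the direct sum is tested
  on each summand.\<close>

definition M_witness ::
  "'a mat \<Rightarrow> 'a mat \<Rightarrow> 'a \<Rightarrow> 'a \<Rightarrow> 'a set \<Rightarrow> 'a set \<Rightarrow> 'a \<Rightarrow> 'a \<Rightarrow> 'a set \<Rightarrow>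
   'a set \<Rightarrow> 'a set \<Rightarrow> 'a set \<Rightarrow> 'a set \<Rightarrow> bool" where
  "M_witness L N p q A B a b I P R Q T \<longleftrightarrow>
     selection (insert p (ground N)) A a I P R \<and> selection (insert q (ground N)) B b I Q T \<and>
     T \<inter> (P \<union> Q) = {} \<and> R \<inter> (P \<union> Q \<union> T) = {} \<and>
     (P \<union> Q \<union> R \<union> T) \<inter> ground N \<in> indeps N \<and> (I \<union> R \<union> T) \<inter> ground L \<in> indeps L"

context construction
begin

lemma K0_indep:
  assumes "I \<subseteq> ground MM" "P \<subseteq> A" "Q \<subseteq> B" "T \<subseteq> insert q (ground N)" "R \<subseteq> insert p (ground N)"
  shows "I \<inter> ground L \<union> P \<union> Q \<union> R \<union> T \<in> indeps K0 \<longleftrightarrow>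
    (P \<union> Q \<union> R \<union> T) \<inter> ground N \<in> indeps N \<and> (I \<union> R \<union> T) \<inter> ground L \<in> indeps L"
proof -
  have "(I \<inter> ground L \<union> P \<union> Q \<union> R \<union> T) \<inter> ground N = (P \<union> Q \<union> R \<union> T) \<inter> ground N"
    "(I \<inter> ground L \<union> P \<union> Q \<union> R \<union> T) \<inter> ground L = (I \<union> R \<union> T) \<inter> ground L"
    "I \<inter> ground L \<union> P \<union> Q \<union> R \<union> T \<subseteq> ground N \<union> ground L"
    using assms NL AB p q by auto
  then show ?thesis unfolding K0_def indeps_direct_sum[OF N L NL] by simp
qed

text \<open>Composes the four reductions with the direct sum test. Later comparisons of independent
  sets work with these witnesses.\<close>

lemma M_indep_iff:
  "I \<in> indeps MM \<longleftrightarrow> I \<subseteq> ground MM \<and> (\<exists>P R Q T. M_witness L N p q A B a b I P R Q T)"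
proof (cases "I \<subseteq> ground MM")
  case False
  then show ?thesis using indep_ground[OF matroid_M] by blast
next
  case True
  let ?S = "I \<inter> ground L"
  have S: "?S \<subseteq> ground L - {p, q}" using True ground_M labels NL p q by auto
  have Z: "I - ground N = I \<inter> ({a, b} \<union> ground L)" using True ground_M NL labels by auto
  have Zb: "I \<inter> ({a, b} \<union> ground L) - {b} = ?S \<union> (I \<inter> {a})" using labels by auto
  have pl: "placed F \<alpha> R \<Longrightarrow> R \<subseteq> F" for F :: "'a set" and \<alpha> R
    by (auto simp: placed_def split: if_splits)
  have pk: "pick A a I P \<alpha> \<Longrightarrow> P \<subseteq> A" "pick B b I P \<alpha> \<Longrightarrow> P \<subseteq> B" for P \<alpha>
    by (auto dest: pick_subset)
  have "I \<in> indeps MM \<longleftrightarrow> (\<exists>Q \<beta>. pick B b I Q \<beta> \<and>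
      ?S \<union> (I \<inter> {a}) \<union> nw ` (I \<inter> A) \<union> Q \<union> {z. z = b \<and> \<beta>} \<in> indeps KA)"
    unfolding M_indep_KB[OF True] Z KB_indep_KA[OF Int_lower2 refl] Zb ..
  also have "\<dots> \<longleftrightarrow> (\<exists>Q \<beta>. pick B b I Q \<beta> \<and> (\<exists>P \<alpha>. pick A a I P \<alpha> \<and>
      ?S \<union> P \<union> Q \<union> {z. z = a \<and> \<alpha>} \<union> {z. z = b \<and> \<beta>} \<in> indeps Kb))"
    by (intro ex_cong1 conj_cong refl, rule KA_indep_Kb[OF Int_lower2 pk(2)])
  also have "\<dots> \<longleftrightarrow> (\<exists>Q \<beta>. pick B b I Q \<beta> \<and> (\<exists>P \<alpha>. pick A a I P \<alpha> \<and>
     (\<exists>T. placed (insert q (ground N)) \<beta> T \<and> T \<inter> (P \<union> Q) = {} \<and>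
        ?S \<union> P \<union> Q \<union> T \<union> {z. z = a \<and> \<alpha>} \<in> indeps Ka)))"
    by (intro ex_cong1 conj_cong refl, rule Kb_indep_Ka[OF S pk])
  also have "\<dots> \<longleftrightarrow> (\<exists>Q \<beta>. pick B b I Q \<beta> \<and> (\<exists>P \<alpha>. pick A a I P \<alpha> \<and>
     (\<exists>T. placed (insert q (ground N)) \<beta> T \<and> T \<inter> (P \<union> Q) = {} \<and>
     (\<exists>R. placed (insert p (ground N)) \<alpha> R \<and> R \<inter> (P \<union> Q \<union> T) = {} \<and>
        ?S \<union> P \<union> Q \<union> R \<union> T \<in> indeps K0))))"
    by (intro ex_cong1 conj_cong refl, rule Ka_indep_K0[OF S pk pl])
  also have "\<dots> \<longleftrightarrow> (\<exists>Q \<beta>. pick B b I Q \<beta> \<and> (\<exists>P \<alpha>. pick A a I P \<alpha> \<and>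
     (\<exists>T. placed (insert q (ground N)) \<beta> T \<and> T \<inter> (P \<union> Q) = {} \<and>
     (\<exists>R. placed (insert p (ground N)) \<alpha> R \<and> R \<inter> (P \<union> Q \<union> T) = {} \<and>
        (P \<union> Q \<union> R \<union> T) \<inter> ground N \<in> indeps N \<and> (I \<union> R \<union> T) \<inter> ground L \<in> indeps L))))"
    by (intro ex_cong1 conj_cong refl, rule K0_indep[OF True pk pl pl])
  also have "\<dots> \<longleftrightarrow> (\<exists>P R Q T. M_witness L N p q A B a b I P R Q T)"
    unfolding M_witness_def selection_def by (safe; blast)
  finally show ?thesis using True by simp
qed

end

subsection \<open>Comparison with the shifted matroids\<close>

lemma natural_classD:
  assumes "natural_class \<M>" "K \<in> \<M>"
  shows "matroid K"
    and "matroid K' \<Longrightarrow> isomorphic K K' \<Longrightarrow> K' \<in> \<M>"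
    and "minor K' K \<Longrightarrow> K' \<in> \<M>"
    and "flat K F \<Longrightarrow> x \<notin> ground K \<Longrightarrow> freely_place K F x \<in> \<M>"
    and "K' \<in> \<M> \<Longrightarrow> ground K \<inter> ground K' = {} \<Longrightarrow> direct_sum K K' \<in> \<M>"
  using assms unfolding natural_class_def by blast+

lemma natural_class_free_ext:
  assumes "natural_class \<M>" "K \<in> \<M>" "S \<subseteq> ground K" "x \<notin> ground K"
  shows "free_ext K S x \<in> \<M>"
  using natural_classD(4)[OF assms(1,2) flat_cl assms(4), of S]
    freely_place_cl[OF _ assms(3,4)] natural_classD(1)[OF assms(1,2)] by simp

lemma natural_class_delete:
  assumes "natural_class \<M>" "K \<in> \<M>" "D \<subseteq> ground K"
  shows "delete K D \<in> \<M>"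
  using natural_classD(3)[OF assms(1,2)] minor_delete[OF natural_classD(1)[OF assms(1,2)] assms(3)] .

lemma natural_class_contract:
  assumes "natural_class \<M>" "K \<in> \<M>" "C \<subseteq> ground K"
  shows "contract K C \<in> \<M>"
  using natural_classD(3)[OF assms(1,2)] minor_contract[OF natural_classD(1)[OF assms(1,2)] assms(3)] .

lemma natural_class_fold:
  assumes nat: "natural_class \<M>" and K: "K \<in> \<M>" and "distinct xs" "insert c (set xs) \<subseteq> ground K"
    "c \<notin> set xs" "inj_on nw (set xs)" "nw ` set xs \<inter> ground K = {}"
  shows "fold (\<lambda>x K. freely_place K (cl K {x, c}) (nw x)) xs K \<in> \<M>"
  using assms(3-)
proof (induction xs rule: rev_induct)
  case Nil
  show ?case using K by simp
next
  case (snoc x xs)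
  let ?K = "fold (\<lambda>x K. freely_place K (cl K {x, c}) (nw x)) xs K"
  have pre: "distinct xs" "insert c (set xs) \<subseteq> ground K" "c \<notin> set xs" "inj_on nw (set xs)"
    "nw ` set xs \<inter> ground K = {}" using snoc.prems by auto
  have in_class: "?K \<in> \<M>" by (rule snoc.IH[OF pre])
  have "ground ?K = ground K \<union> nw ` set xs"
    using fold_freely_place[OF natural_classD(1)[OF nat K] pre] by blast
  then have "nw x \<notin> ground ?K" using snoc.prems by auto
  then show ?case
    using natural_classD(4)[OF nat in_class flat_cl[OF natural_classD(1)[OF nat in_class]]] by simp
qed

lemma selection_cases:
  assumes "selection F A a I P R"
  obtains "a \<notin> I" "P = I \<inter> A" "R = {}"
    | f where "a \<in> I" "P = I \<inter> A" "f \<in> F" "R = {f}"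
    | x f where "a \<notin> I" "x \<in> I \<inter> A" "P = I \<inter> A - {x}" "f \<in> F" "R = {f}"
  using assms unfolding selection_def pick_def placed_def by (auto split: if_splits)

lemma selection_replace:
  assumes "selection F A a I P {f}" "f' \<in> F"
  shows "selection F A a I P {f'}"
  using assms unfolding selection_def placed_def by (auto split: if_splits)

lemma selection_subset:
  assumes "selection F A a I P R"
  shows "P \<subseteq> I \<inter> A" "R \<subseteq> F"
  using assms by (auto elim: selection_cases)

lemma M_witness_commute:
  "M_witness L N p q A B a b I P R Q T \<longleftrightarrow> M_witness L N q p B A b a I Q T P R"
  unfolding M_witness_def by (simp add: Un_ac) blast

context construction
begin

lemma M_in_class:
  assumes nat: "natural_class \<M>" and "L \<in> \<M>" "N \<in> \<M>"
  shows "MM \<in> \<M>"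
proof -
  have "K0 \<in> \<M>" unfolding K0_def using natural_classD(5)[OF nat assms(3,2) NL] .
  then have "Ka \<in> \<M>" unfolding Ka_def using natural_class_free_ext[OF nat _ Ka_prems] by blast
  then have "Kb \<in> \<M>" unfolding Kb_def using natural_class_free_ext[OF nat _ Kb_prems] by blast
  then have "KA \<in> \<M>" unfolding KA_def using natural_class_fold[OF nat _ xs(1) KA_prems] by blast
  then have KBM: "KB \<in> \<M>" unfolding KB_def using natural_class_fold[OF nat _ ys(1) KB_prems] by blast
  have "ground N \<subseteq> ground KB" unfolding KB(2) by auto
  then have "delete KB (ground N) \<in> \<M>" by (rule natural_class_delete[OF nat KBM])
  then have rel: "relabel lab (delete KB (ground N)) \<in> \<M>"
    using natural_classD(2)[OF nat] matroid_relabelled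
      isomorphic_relabel[OF matroid_delete[OF KB(1)] lab_inj] by blast
  show ?thesis unfolding M_eq
    by (rule natural_class_delete[OF nat rel]) (use p q in \<open>simp add: ground_relabelled\<close>)
qed

lemma change_L:
  assumes "matroid L'" "ground L' \<subseteq> ground L" "p \<in> ground L'" "q \<in> ground L'"
  shows "construction L' N p q A B xs ys a b nw"
proof unfold_locales
  show "ground N \<inter> ground L' = {}" using NL assms(2) by blast
  show "fresh_labels L' N a b nw" using fresh assms(2) unfolding fresh_labels_def by blast
qed (use assms N pq AB xs ys in auto)

text \<open>\<open>L'\<close> stands for the shifted matroid. Independence in \<open>L\<close>
  implies independence in \<open>L'\<close>, so only a witness for \<open>L'\<close> that uses
  \<open>p\<close> in place of \<open>q\<close> needs repair. Condition \<open>ex\<close> excludes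
  the one configuration where repair may fail: all of \<open>insert a A\<close> is present and
  nothing from \<open>insert b B\<close> is there to supply \<open>q\<close>.\<close>

lemma M_witness_shift:
  assumes g: "ground L' = ground L"
    and i: "\<And>W. W \<in> indeps L' \<longleftrightarrow> W \<in> indeps L \<or> p \<in> W \<and> q \<notin> W \<and> insert q (W - {p}) \<in> indeps L"
    and A: "A \<in> indeps N" and I: "p \<notin> I" "q \<notin> I"
    and ex: "I \<inter> insert b B \<noteq> {} \<or> \<not> insert a A \<subseteq> I"
  shows "(\<exists>P R Q T. M_witness L N p q A B a b I P R Q T) \<longleftrightarrow>
    (\<exists>P R Q T. M_witness L' N p q A B a b I P R Q T)"
proof
  assume "\<exists>P R Q T. M_witness L N p q A B a b I P R Q T"
  then show "\<exists>P R Q T. M_witness L' N p q A B a b I P R Q T"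
    unfolding M_witness_def g i by blast
next
  assume "\<exists>P R Q T. M_witness L' N p q A B a b I P R Q T"
  then obtain P R Q T where w: "M_witness L' N p q A B a b I P R Q T" by blast
  show "\<exists>P R Q T. M_witness L N p q A B a b I P R Q T"
  proof (cases "(I \<union> R \<union> T) \<inter> ground L \<in> indeps L")
    case True
    then show ?thesis using w unfolding M_witness_def g by blast
  next
    case False
    have sP: "selection (insert p (ground N)) A a I P R"
      and sQ: "selection (insert q (ground N)) B b I Q T"
      and dj: "T \<inter> (P \<union> Q) = {}" "R \<inter> (P \<union> Q \<union> T) = {}"
      and iN: "(P \<union> Q \<union> R \<union> T) \<inter> ground N \<in> indeps N"
      and iL: "(I \<union> R \<union> T) \<inter> ground L \<in> indeps L'"
      using w unfolding M_witness_def g by auto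
    have pN: "p \<notin> ground N" "q \<notin> ground N" using p q NL by auto
    note sub = selection_subset[OF sP] selection_subset[OF sQ]
    have *: "p \<in> I \<union> R \<union> T" "q \<notin> I \<union> R \<union> T" "insert q ((I \<union> R \<union> T) \<inter> ground L - {p}) \<in> indeps L"
      using iL False p q unfolding i by auto
    \<comment> \<open>Neither \<open>I\<close> nor \<open>T\<close> can supply \<open>p\<close>:
      \<open>I\<close> omits it, and \<open>T\<close> is contained in
      \<open>insert q (ground N)\<close>.\<close>
    have "p \<in> R" using *(1) I sub pq pN by auto
    then have R: "R = {p}" using sP by (auto elim: selection_cases)
    have "T \<subseteq> ground N" using sub *(2) by auto
    then have "(I \<union> R \<union> T) \<inter> ground L - {p} = I \<inter> ground L" using R NL I by auto
    then have Lq: "insert q (I \<inter> ground L) \<in> indeps L" using *(3) by simp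
    then have L0: "I \<inter> ground L \<in> indeps L" by (rule indep_subset[OF L]) auto
    have PQ: "P \<subseteq> ground N" "Q \<subseteq> ground N" "P \<inter> Q = {}" using sub AB by auto
    have iN': "P \<union> Q \<union> T \<in> indeps N"
    proof -
      have "(P \<union> Q \<union> R \<union> T) \<inter> ground N = P \<union> Q \<union> T"
        using PQ \<open>T \<subseteq> ground N\<close> R pN by auto
      with iN show ?thesis by simp
    qed
    \<comment> \<open>The new elements \<open>a\<close> and \<open>b\<close> trade places: \<open>b\<close> is specialised to \<open>q\<close>, and \<open>a\<close> to whatever
      element of \<open>N\<close> stood for \<open>b\<close>.\<close>
    have swap: ?thesis if Q': "selection (insert q (ground N)) B b I Q' {q}" "Q' \<subseteq> Q"
      and f: "f \<in> ground N" "f \<notin> P \<union> Q'" "P \<union> Q' \<union> {f} = P \<union> Q \<union> T" for Q' f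
    proof -
      have "selection (insert p (ground N)) A a I P {f}"
        using selection_replace[OF sP[unfolded R]] f by auto
      moreover have "(P \<union> Q' \<union> {f} \<union> {q}) \<inter> ground N = P \<union> Q \<union> T"
        using f PQ Q' pN \<open>T \<subseteq> ground N\<close> by auto
      moreover have "(I \<union> {f} \<union> {q}) \<inter> ground L = insert q (I \<inter> ground L)"
        using f NL q by auto
      moreover have "{q} \<inter> (P \<union> Q') = {}" "{f} \<inter> (P \<union> Q' \<union> {q}) = {}"
        using f PQ Q' pN by auto
      ultimately have "M_witness L N p q A B a b I P {f} Q' {q}"
        unfolding M_witness_def using Q' iN' Lq by (simp only:)
      then show ?thesis by blast
    qed
    from sQ show ?thesis
    proof (cases rule: selection_cases)
      case 1
      show ?thesis
      proof (cases "I \<inter> B = {}")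
        \<comment> \<open>Specialise the copy of \<open>y\<close> to \<open>b\<close> and then to
          \<open>q\<close>, and let \<open>a\<close> take \<open>y\<close>. The set in
          \<open>N\<close> is unchanged, while the set in \<open>L\<close> has \<open>q\<close>
          instead of \<open>p\<close>.\<close>
        case False
        then obtain y where y: "y \<in> I \<inter> B" by blast
        have "selection (insert q (ground N)) B b I (Q - {y}) {q}"
          unfolding selection_def pick_def placed_def using 1 y by auto
        then show ?thesis
          by (rule swap[where f = y]) (use y 1 AB PQ sub in auto)
      next
        case True
        then have nA: "\<not> insert a A \<subseteq> I" using ex 1 by auto
        \<comment> \<open>No element of \<open>B\<close> occurs, so \<open>P\<close> with a further
          \<open>f\<close> in \<open>A\<close> is still part of the independent set
          \<open>A\<close>. Such an \<open>f\<close> exists: if \<open>a\<close> is in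
          \<open>I\<close>, some element of \<open>A\<close> is not; otherwise the copy specialised
          to \<open>a\<close> has left \<open>P\<close>. Then \<open>a\<close> takes
          \<open>f\<close>, and neither \<open>p\<close> nor \<open>q\<close> is used.\<close>
        have "\<not> A \<subseteq> P" using sP
        proof (cases rule: selection_cases)
          case 1 then show ?thesis using R by simp
        next
          case 2 then show ?thesis using nA by auto
        next
          case (3 x f) then show ?thesis by auto
        qed
        then obtain f where f: "f \<in> A" "f \<notin> P" by blast
        then have fN: "f \<in> ground N" using AB by auto
        have "selection (insert p (ground N)) A a I P {f}"
          using selection_replace[OF sP[unfolded R]] fN by auto
        moreover have "(P \<union> Q \<union> {f} \<union> {}) \<inter> ground N \<in> indeps N"
          by (rule indep_subset[OF N A]) (use f sub 1 True in auto)
        moreover have "(I \<union> {f} \<union> {}) \<inter> ground L = I \<inter> ground L" using fN NL by auto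
        moreover have "{f} \<inter> (P \<union> Q \<union> {}) = {}" using f 1 True by auto
        ultimately have "M_witness L N p q A B a b I P {f} Q {}"
          unfolding M_witness_def using sQ 1 L0 by simp
        then show ?thesis by blast
      qed
    next
      case (2 g)
      have "selection (insert q (ground N)) B b I Q {q}"
        using selection_replace[OF sQ[unfolded 2(4)]] by auto
      then show ?thesis
        by (rule swap[where f = g]) (use 2 dj \<open>T \<subseteq> ground N\<close> in auto)
    next
      case (3 y g)
      have "selection (insert q (ground N)) B b I Q {q}"
        using selection_replace[OF sQ[unfolded 3(5)]] by auto
      then show ?thesis
        by (rule swap[where f = g]) (use 3 dj \<open>T \<subseteq> ground N\<close> in auto)
    qed
  qed
qed

lemma M_indep_shift:
  assumes inf: "infinite (UNIV :: 'a set)" and A: "A \<in> indeps N"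
    and ex: "I \<inter> insert b B \<noteq> {} \<or> \<not> insert a A \<subseteq> I"
  shows "I \<in> indeps MM \<longleftrightarrow> I \<in> indeps (M (shift L p q) p q N xs ys a b nw)"
proof -
  note sh = shift_characterization[OF inf L p q pq]
  interpret s: construction "shift L p q" N p q A B xs ys a b nw
    by (rule change_L) (use sh p q in auto)
  show ?thesis
  proof (cases "I \<subseteq> ground MM")
    case True
    then have "p \<notin> I" "q \<notin> I" unfolding ground_M using labels p q NL by auto
    from M_witness_shift[OF sh(2,3) A this ex] show ?thesis
      unfolding M_indep_iff s.M_indep_iff ground_M s.ground_M sh(2) by blast
  next
    case False
    then show ?thesis unfolding M_indep_iff s.M_indep_iff ground_M s.ground_M sh(2) by blast
  qed
qed

lemma construction_commute: "construction L N q p B A ys xs b a nw"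
proof unfold_locales
  show "fresh_labels L N b a nw" using fresh unfolding fresh_labels_def by (auto simp: insert_commute)
qed (use L N NL p q pq AB xs ys in auto)

text \<open>The witnesses are symmetric in the two sides, so the order of placement does not matter.
  Results about \<open>shift L p q\<close> thereby transfer to \<open>shift L q p\<close>.\<close>

lemma M_commute: "M L q p N ys xs b a nw = MM"
proof -
  interpret c: construction L N q p B A ys xs b a nw by (rule construction_commute)
  have g: "ground (M L q p N ys xs b a nw) = ground MM" unfolding ground_M c.ground_M by auto
  show ?thesis
  proof (rule mat.expand, intro conjI set_eqI)
    show "I \<in> indeps (M L q p N ys xs b a nw) \<longleftrightarrow> I \<in> indeps MM" for I
      unfolding M_indep_iff c.M_indep_iff g M_witness_commute[of L N q p B A b a] by blast
  qed (use g in auto)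
qed

text \<open>The element \<open>e\<close> can be specialised, through \<open>a\<close> if it is a
  copy, to the nonloop \<open>p\<close>. This makes \<open>contract_nonloop\<close>
  applicable.\<close>

lemma M_nonloop:
  assumes "e \<in> insert a A" "{p} \<in> indeps L"
  shows "{e} \<in> indeps MM"
proof -
  have e: "e \<notin> insert b B" "e \<notin> ground L" using assms(1) AB labels NL by auto
  have "selection (insert p (ground N)) A a {e} {} {p}"
    unfolding selection_def pick_def placed_def using assms(1) labels AB by auto
  moreover have "selection (insert q (ground N)) B b {e} {} {}"
    unfolding selection_def pick_def placed_def using e by auto
  moreover have "{p} \<inter> ground N = {}" "({e} \<union> {p}) \<inter> ground L = {p}" using p NL e by auto
  ultimately have "M_witness L N p q A B a b {e} {} {p} {} {}"
    unfolding M_witness_def using assms(2) indep_empty[OF N] by simp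
  moreover have "{e} \<subseteq> ground MM" unfolding ground_M using assms(1) AB by auto
  ultimately show ?thesis unfolding M_indep_iff by blast
qed

text \<open>A set avoiding some element of \<open>insert a A\<close> is never in the exceptional
  configuration of \<open>M_witness_shift\<close>.\<close>

lemma delete_M_shift:
  assumes "infinite (UNIV :: 'a set)" "A \<in> indeps N" "e \<in> insert a A"
  shows "delete MM {e} = delete (M (shift L p q) p q N xs ys a b nw) {e}"
proof (rule delete_eqI)
  note sh = shift_characterization[OF assms(1) L p q pq]
  interpret s: construction "shift L p q" N p q A B xs ys a b nw
    by (rule change_L) (use sh p q in auto)
  show "ground MM = ground (M (shift L p q) p q N xs ys a b nw)"
    unfolding ground_M s.ground_M sh(2) ..
  show "I \<in> indeps MM \<longleftrightarrow> I \<in> indeps (M (shift L p q) p q N xs ys a b nw)" if "e \<notin> I" for I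
    by (rule M_indep_shift[OF assms(1,2)]) (use that assms(3) in blast)
qed

text \<open>The independent sets of the contraction come from sets containing \<open>e\<close>.
  These meet \<open>insert b B\<close>, so the exceptional configuration does not arise.\<close>

lemma contract_M_shift:
  assumes "infinite (UNIV :: 'a set)" "A \<in> indeps N" "e \<in> insert b B" "{q} \<in> indeps L"
  shows "contract MM {e} = contract (M (shift L p q) p q N xs ys a b nw) {e}"
proof -
  note sh = shift_characterization[OF assms(1) L p q pq]
  interpret s: construction "shift L p q" N p q A B xs ys a b nw
    by (rule change_L) (use sh p q in auto)
  interpret c: construction L N q p B A ys xs b a nw by (rule construction_commute)
  have eq: "insert e I \<in> indeps MM \<longleftrightarrow> insert e I \<in> indeps (M (shift L p q) p q N xs ys a b nw)" for I
    by (rule M_indep_shift[OF assms(1,2)]) (use assms(3) in blast)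
  have nl: "{e} \<in> indeps MM" using c.M_nonloop[OF assms(3,4)] unfolding M_commute .
  then have nl': "{e} \<in> indeps (M (shift L p q) p q N xs ys a b nw)" using eq[of "{}"] by simp
  show ?thesis
    unfolding contract_nonloop[OF matroid_M nl] contract_nonloop[OF s.matroid_M nl']
      eq ground_M s.ground_M sh(2) ..
qed

section \<open>Deleting or contracting an element of \<open>L\<close> other than \<open>p\<close>
  and \<open>q\<close>\<close>

lemma delete_M:
  assumes e: "e \<in> ground L - {p, q}"
  shows "delete MM {e} = M (delete L {e}) p q N xs ys a b nw"
proof -
  interpret d: construction "delete L {e}" N p q A B xs ys a b nw
    by (rule change_L) (use matroid_delete[OF L] e p q in auto)
  have eN: "e \<notin> ground N" "e \<noteq> a" "e \<noteq> b" using e NL labels by auto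
  show ?thesis
  proof (rule mat.expand, intro conjI set_eqI)
    show "x \<in> ground (delete MM {e}) \<longleftrightarrow> x \<in> ground (M (delete L {e}) p q N xs ys a b nw)" for x
      unfolding ground_delete[of MM] ground_M d.ground_M using eN by auto
    fix I
    have w: "M_witness (delete L {e}) N p q A B a b I P R Q T \<longleftrightarrow> M_witness L N p q A B a b I P R Q T"
      if "e \<notin> I" for P R Q T
    proof -
      have "(I \<union> R \<union> T) \<inter> ground (delete L {e}) \<in> indeps (delete L {e}) \<longleftrightarrow> (I \<union> R \<union> T) \<inter> ground L \<in> indeps L"
        if "selection (insert p (ground N)) A a I P R" "selection (insert q (ground N)) B b I Q T"
      proof -
        have "e \<notin> R" "e \<notin> T" using selection_subset(2)[OF that(1)] selection_subset(2)[OF that(2)] e eN by auto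
        then have "(I \<union> R \<union> T) \<inter> (ground L - {e}) = (I \<union> R \<union> T) \<inter> ground L" using \<open>e \<notin> I\<close> by auto
        then show ?thesis using \<open>e \<notin> I\<close> \<open>e \<notin> R\<close> \<open>e \<notin> T\<close> by simp
      qed
      then show ?thesis unfolding M_witness_def by blast
    qed
    have gd: "I \<subseteq> ground (M (delete L {e}) p q N xs ys a b nw) \<longleftrightarrow> I \<subseteq> ground MM \<and> e \<notin> I"
      unfolding ground_M d.ground_M using eN by auto
    show "I \<in> indeps (delete MM {e}) \<longleftrightarrow> I \<in> indeps (M (delete L {e}) p q N xs ys a b nw)"
      unfolding d.M_indep_iff gd indeps_delete[of MM] using w M_indep_iff[of I] by blast
  qed
qed

text \<open>A loop of \<open>L\<close> is a loop of the construction, and contracting it means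
  deleting it. For a nonloop, adding \<open>e\<close> to \<open>I\<close> changes neither the
  selections nor the part of a witness in \<open>N\<close>. That \<open>contract L {e}\<close> is a
  matroid will follow from its membership in the class.\<close>

lemma contract_M:
  assumes e: "e \<in> ground L - {p, q}" and Le: "matroid (contract L {e})"
  shows "contract MM {e} = M (contract L {e}) p q N xs ys a b nw"
proof (cases "{e} \<in> indeps L")
  case False
  have "{e} \<notin> indeps MM"
  proof
    assume "{e} \<in> indeps MM"
    then obtain P R Q T where "({e} \<union> R \<union> T) \<inter> ground L \<in> indeps L"
      unfolding M_indep_iff M_witness_def by blast
    then have "{e} \<in> indeps L" by (rule indep_subset[OF L]) (use e in auto)
    with False show False by blast
  qed
  then show ?thesis
    by (simp add: contract_loop[OF matroid_M] contract_loop[OF L False] delete_M[OF e])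
next
  case True
  interpret d: construction "contract L {e}" N p q A B xs ys a b nw
    by (rule change_L) (use Le e p q in auto)
  have eN: "e \<notin> ground N" "e \<noteq> a" "e \<noteq> b" using e NL labels by auto
  have eAB: "e \<notin> A" "e \<notin> B" using eN AB by auto
  have "M_witness L N p q A B a b {e} {} {} {} {}"
    unfolding M_witness_def selection_def pick_def placed_def
    using eN eAB True indep_empty[OF N] e by auto
  moreover have "{e} \<subseteq> ground MM" unfolding ground_M using e by auto
  ultimately have nl: "{e} \<in> indeps MM" unfolding M_indep_iff by blast
  show ?thesis
  proof (rule mat.expand, intro conjI set_eqI)
    show "x \<in> ground (contract MM {e}) \<longleftrightarrow> x \<in> ground (M (contract L {e}) p q N xs ys a b nw)" for x
      unfolding ground_contract[of MM] ground_M d.ground_M using eN by auto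
    fix I
    have w: "M_witness (contract L {e}) N p q A B a b I P R Q T \<longleftrightarrow> M_witness L N p q A B a b (insert e I) P R Q T"
      if "e \<notin> I" for P R Q T
    proof -
      have s: "selection F A a (insert e I) P R \<longleftrightarrow> selection F A a I P R"
        "selection F B b (insert e I) Q T \<longleftrightarrow> selection F B b I Q T" for F
        unfolding selection_def pick_def using eN eAB by auto
      have "(I \<union> R \<union> T) \<inter> ground (contract L {e}) \<in> indeps (contract L {e}) \<longleftrightarrow>
        (insert e I \<union> R \<union> T) \<inter> ground L \<in> indeps L"
      proof -
        have "insert e ((I \<union> R \<union> T) \<inter> (ground L - {e})) = (insert e I \<union> R \<union> T) \<inter> ground L"
          using e by auto
        then show ?thesis by (simp add: contract_nonloop[OF L True] le_infI2)
      qed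
      then show ?thesis unfolding M_witness_def s by blast
    qed
    have gd: "I \<subseteq> ground (M (contract L {e}) p q N xs ys a b nw) \<longleftrightarrow> insert e I \<subseteq> ground MM \<and> e \<notin> I"
      unfolding ground_M d.ground_M using eN e by auto
    have "I \<in> indeps (contract MM {e}) \<longleftrightarrow> e \<notin> I \<and> insert e I \<in> indeps MM"
      using indep_ground[OF matroid_M, of "insert e I"]
      unfolding contract_nonloop[OF matroid_M nl] mat.sel mem_Collect_eq by blast
    also have "\<dots> \<longleftrightarrow> I \<in> indeps (M (contract L {e}) p q N xs ys a b nw)"
    proof (cases "e \<in> I")
      case True
      then show ?thesis unfolding d.M_indep_iff gd by simp
    next
      case False
      then show ?thesis unfolding d.M_indep_iff gd M_indep_iff[of "insert e I"] w[OF False] by simp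
    qed
    finally show "I \<in> indeps (contract MM {e}) \<longleftrightarrow> I \<in> indeps (M (contract L {e}) p q N xs ys a b nw)" .
  qed
qed

text \<open>Half of the minors at elements outside \<open>L\<close>. The other half, contraction at
  \<open>insert a A\<close> and deletion at \<open>insert b B\<close>, is this lemma with the roles
  exchanged.\<close>

lemma minors_M_shift:
  assumes inf: "infinite (UNIV :: 'a set)" and nat: "natural_class \<M>"
    and A: "A \<in> indeps N" and "shift L p q \<in> \<M>" "N \<in> \<M>" and q1: "{q} \<in> indeps L"
  shows "e \<in> insert a A \<Longrightarrow> delete MM {e} \<in> \<M>" "e \<in> insert b B \<Longrightarrow> contract MM {e} \<in> \<M>"
proof -
  note sh = shift_characterization[OF inf L p q pq]
  interpret s: construction "shift L p q" N p q A B xs ys a b nw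
    by (rule change_L) (use sh p q in auto)
  have Ms: "M (shift L p q) p q N xs ys a b nw \<in> \<M>" by (rule s.M_in_class[OF nat assms(4,5)])
  show "delete MM {e} \<in> \<M>" if "e \<in> insert a A"
    unfolding delete_M_shift[OF inf A that]
    by (rule natural_class_delete[OF nat Ms]) (use that AB in \<open>auto simp: s.ground_M\<close>)
  show "contract MM {e} \<in> \<M>" if "e \<in> insert b B"
    unfolding contract_M_shift[OF inf A that q1]
    by (rule natural_class_contract[OF nat Ms]) (use that AB in \<open>auto simp: s.ground_M\<close>)
qed

end

text \<open>An element that some set fails to span extends a basis of that set, so it is not a loop.
  Incomparability provides such a set for each of \<open>p\<close> and \<open>q\<close>.\<close>

lemma incomparable_pair_nonloop:
  assumes L: "matroid L" and "incomparable_pair L p q"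
  shows "{p} \<in> indeps L" "{q} \<in> indeps L"
proof -
  have nl: "{z} \<in> indeps L" if "z \<in> ground L" "\<not> spans L S {z}" for z S
  proof -
    obtain B where B: "basis_of L S B" using basis_of_exists[OF L] .
    have "insert z B \<in> indeps L" using cl_iff_basis[OF L B, of z] that by (auto simp: spans_def)
    then show ?thesis by (rule indep_subset[OF L]) auto
  qed
  show "{p} \<in> indeps L" "{q} \<in> indeps L"
    using assms(2) nl unfolding incomparable_pair_def by blast+
qed

theorem theorem4p7:
  fixes \<M> :: "'a mat set" and L N :: "'a mat" and p q a b :: 'a
    and A B :: "'a set" and xs ys :: "'a list" and nw :: "'a \<Rightarrow> 'a"
  assumes "infinite (UNIV :: 'a set)"
    and "natural_class \<M>"
    and "matroid L" and "matroid N" and "ground N \<inter> ground L = {}"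
    and "p \<in> ground L" and "q \<in> ground L" and "p \<noteq> q"
    and "A \<union> B = ground N" and "A \<inter> B = {}" and "base N A" and "base N B"
    and "excluded_minor \<M> L"
    and "incomparable_pair L p q" and "shift L p q \<in> \<M>" and "shift L q p \<in> \<M>"
    and "N \<in> \<M>"
    and "distinct xs" and "set xs = A" and "distinct ys" and "set ys = B"
    and "fresh_labels L N a b nw"
  shows "\<forall>K. proper_minor K (M L p q N xs ys a b nw) \<longrightarrow> K \<in> \<M>"
proof (intro allI impI)
  interpret construction L N p q A B xs ys a b nw
    using assms by unfold_locales
  interpret c: construction L N q p B A ys xs b a nw by (rule construction_commute)
  have A: "A \<in> indeps N" and B: "B \<in> indeps N"
    using assms(11,12) by (auto simp: base_def dest: basis_ofD)
  note nonloop = incomparable_pair_nonloop[OF assms(3,14)]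
  note p_to_q = minors_M_shift[OF assms(1,2) A assms(15,17) nonloop(2)]
  note q_to_p = c.minors_M_shift[OF assms(1,2) B assms(16,17) nonloop(1), unfolded M_commute]
  fix K assume "proper_minor K MM"
  then obtain e where e: "e \<in> ground MM" and K: "minor K (delete MM {e}) \<or> minor K (contract MM {e})"
    using proper_minor_cases[OF matroid_M] by blast
  have "delete MM {e} \<in> \<M> \<and> contract MM {e} \<in> \<M>"
  proof (cases "e \<in> ground L - {p, q}")
    case True
    have del: "delete L {e} \<in> \<M>" and con: "contract L {e} \<in> \<M>"
      using assms(13) True proper_minor_delete[OF assms(3)] proper_minor_contract[OF assms(3)]
      unfolding excluded_minor_def by auto
    note con_matroid = natural_classD(1)[OF assms(2) con]
    interpret d: construction "delete L {e}" N p q A B xs ys a b nw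
      by (rule change_L) (use matroid_delete[OF assms(3)] True p q in auto)
    interpret d': construction "contract L {e}" N p q A B xs ys a b nw
      by (rule change_L) (use con_matroid True p q in auto)
    show ?thesis
      unfolding delete_M[OF True] contract_M[OF True con_matroid]
      using d.M_in_class[OF assms(2) del assms(17)] d'.M_in_class[OF assms(2) con assms(17)] by blast
  next
    case False
    \<comment> \<open>For \<open>e\<close> in \<open>insert a A\<close>, deletion is covered by
      \<open>p_to_q\<close> and contraction by \<open>q_to_p\<close>; for \<open>e\<close> in
      \<open>insert b B\<close> it is the other way round.\<close>
    then have "e \<in> insert a A \<or> e \<in> insert b B" using e AB unfolding ground_M by auto
    then show ?thesis using p_to_q q_to_p by blast
  qed
  then show "K \<in> \<M>" using K natural_classD(3)[OF assms(2)] by blast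
qed

end
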